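(* Let $G$ be a unicyclic graph of order $n$. Then $\iota(G)=n/3$ if and only if $G\in \mathcal{U}\cup\{C_6,C_9\}$.
   Context: Graphs are finite and simple, considered up to isomorphism; the order of a graph is its number of vertices. $P_k$, $C_k$ and $K_k$ denote the path, cycle and complete graph of order $k$. For a graph $G=(V,E)$ and $D\subseteq V$, $N[D]$ is the set of vertices that belong to $D$ or have a neighbor in $D$. A set $D\subseteq V$ is isolating if $V\setminus N[D]$ is an independent set. The isolation number $\iota(G)$ is the minimum cardinality of an isolating set of $G$. A graph is unicyclic if it is connected and contains exactly one cycle. Attachable graphs. Each of the following graphs has one distinguished ("circled") vertex: $P_3$, whose circled vertex is one of its leaves; $C_3$, whose circled vertex is any of its vertices; and $H_6^1, H_6^{2a}, H_6^{2b}, H_6^3$, each of which consists of an (induced) cycle $C_5$ together with a sixth vertex, the circled one, which is adjacent to, respectively, exactly one vertex of the cycle ($H_6^1$), exactly two vertices of the cycle (the two graphs $H_6^{2a}$ and $H_6^{2b}$: one in which these two vertices are adjacent in the cycle, the other in which they are not), and exactly three vertices of the cycle, which are consecutive in the cycle ($H_6^3$). The family $\mathcal{G}$ consists of all graphs obtained from a connected graph $G_0$ (with at least one vertex) by attaching at every vertex $v$ of $G_0$ exactly one copy of one of the graphs $P_3, C_3, H_6^1, H_6^{2a}, H_6^{2b}, H_6^3$, by identifying $v$ with the circled vertex of the attached copy (copies attached at different vertices are disjoint, and the choice of the attached graph may vary from vertex to vertex). $\mathcal{U}$ is the family of all unicyclic graphs belonging to $\mathcal{G}$. *)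

theory Defs
  imports Complex_Main "Graph_Theory.Graph_Theory"
begin

text \<open>
  Finite simple graphs are rendered as \<^locale>\<open>pair_graph\<close>: finite, loop-free, and with a
  symmetric set of arcs, so that an edge $uv$ is the two arcs \<open>(u, v)\<close> and \<open>(v, u)\<close>.
  \<^const>\<open>Digraph_Component.connected\<close> includes that there is at least one vertex.
\<close>

definition edge_graph :: "'a set \<Rightarrow> ('a \<times> 'a) set \<Rightarrow> 'a pair_pre_digraph" where
  "edge_graph V E = \<lparr>pverts = V, parcs = E \<union> E\<inverse>\<rparr>"

definition path_graph :: "nat \<Rightarrow> nat pair_pre_digraph" where
  "path_graph k = edge_graph {..<k} {(i, Suc i) |i. Suc i < k}"

text \<open>The following is the cycle $C_k$ only for $k \ge 3$.\<close>

definition cycle_graph :: "nat \<Rightarrow> nat pair_pre_digraph" where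
  "cycle_graph k = edge_graph {..<k} {(i, Suc i mod k) |i. i < k}"

definition closed_nbhd :: "'a pair_pre_digraph \<Rightarrow> 'a set \<Rightarrow> 'a set" where
  "closed_nbhd G D = {v \<in> pverts G. v \<in> D \<or> (\<exists>u\<in>D. (u, v) \<in> parcs G)}"

definition independent_set :: "'a pair_pre_digraph \<Rightarrow> 'a set \<Rightarrow> bool" where
  "independent_set G S \<longleftrightarrow> S \<subseteq> pverts G \<and> (\<forall>u\<in>S. \<forall>v\<in>S. (u, v) \<notin> parcs G)"

definition isolating :: "'a pair_pre_digraph \<Rightarrow> 'a set \<Rightarrow> bool" where
  "isolating G D \<longleftrightarrow> D \<subseteq> pverts G \<and> independent_set G (pverts G - closed_nbhd G D)"

definition isolation_number :: "'a pair_pre_digraph \<Rightarrow> nat" where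
  "isolation_number G = Min (card ` {D. isolating G D})"

text \<open>
  A cycle of a graph is a subgraph isomorphic to some $C_k$ with $k \ge 3$. The library's
  \<^const>\<open>pre_digraph.cycle\<close> is not suitable here: it is about directed closed walks with a
  starting point, and going back and forth along one edge is such a cycle.
\<close>

definition is_cycle_of :: "'a pair_pre_digraph \<Rightarrow> 'a pair_pre_digraph \<Rightarrow> bool" where
  "is_cycle_of C G \<longleftrightarrow> subgraph C G \<and> (\<exists>k\<ge>3. digraph_iso C (cycle_graph k))"

definition unicyclic :: "'a pair_pre_digraph \<Rightarrow> bool" where
  "unicyclic G \<longleftrightarrow> connected G \<and> (\<exists>!C. is_cycle_of C G)"

text \<open>
  In the attachable graphs the circled vertex is always \<open>0\<close>. In \<open>H6 S\<close> the induced 5-cycle is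
  \<open>1, 2, 3, 4, 5\<close> and \<open>S\<close> is the set of neighbours of the circled vertex.
\<close>

definition H6 :: "nat set \<Rightarrow> nat pair_pre_digraph" where
  "H6 S = edge_graph {0..5} ({(1, 2), (2, 3), (3, 4), (4, 5), (5, 1)} \<union> {0} \<times> S)"

definition attachable :: "nat pair_pre_digraph set" where
  "attachable =
     {path_graph 3, cycle_graph 3, H6 {1}, H6 {1, 2}, H6 {1, 3}, H6 {1, 2, 3}}"

text \<open>
  The copy of \<open>A v\<close> attached at \<open>v\<close> lives on the vertices \<open>(v, i)\<close>; its circled vertex
  \<open>(v, 0)\<close> is identified with \<open>v\<close>.
\<close>

definition attach ::
  "'a pair_pre_digraph \<Rightarrow> ('a \<Rightarrow> nat pair_pre_digraph) \<Rightarrow> ('a \<times> nat) pair_pre_digraph" where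
  "attach G0 A =
     \<lparr>pverts = (SIGMA v:pverts G0. pverts (A v)),
      parcs = {((u, 0), (v, 0)) |u v. (u, v) \<in> parcs G0} \<union>
              {((v, i), (v, j)) |v i j. v \<in> pverts G0 \<and> (i, j) \<in> parcs (A v)}\<rparr>"

text \<open>
  The family is closed under isomorphism. Taking $G_0$ on the vertex type of $G$ is no
  restriction, since $G_0$ has at most as many vertices as $G$.
\<close>

definition family_G :: "'a pair_pre_digraph set" where
  "family_G = {G :: 'a pair_pre_digraph. \<exists>(G0 :: 'a pair_pre_digraph) A.
     pair_graph G0 \<and> connected G0 \<and> (\<forall>v\<in>pverts G0. A v \<in> attachable) \<and>
     digraph_iso G (attach G0 A)}"

definition family_U :: "'a pair_pre_digraph set" where
  "family_U = {G \<in> family_G. unicyclic G}"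

end

theory Submission
  imports Defs
begin

text \<open>
  A connected unicyclic graph is the graph of a map \<open>f\<close> with edges \<open>v f(v)\<close>: on the cycle \<open>f\<close> moves one
  step on, elsewhere it moves towards the cycle. Removing the set of vertices that reach \<open>x\<close> in at
  most two steps, where \<open>x\<close> is off the cycle and lies two steps below a vertex of maximal height,
  again leaves such a graph; the removed part has at least three vertices and is taken care of by
  putting \<open>x\<close> into the isolating set. By induction the isolation number is less than \<open>n / 3\<close> unless
  the rest is extremal and exactly three vertices, forming a path, were removed. As \<open>x\<close> also dominates
  \<open>f(x)\<close>, one vertex of the rest can then be saved unless \<open>f(x)\<close> is a circled vertex, in which case
  the path is one more attached \<open>P\<^sub>3\<close>. If every vertex has height at most two, an isolating set is
  chosen directly along the cycle.
\<close>

section \<open>Graphs of maps with one cycle\<close>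

text \<open>In the graph of a map every edge is a pair \<open>v\<close>, \<open>f v\<close>, so
  isolation becomes a condition on single vertices, and \<open>dominates f D v\<close> is membership
  of \<open>v\<close> in N[D]. Cutting off vertices changes neither \<open>f\<close> nor the cycle.
  The obstacle is that n/3 leaves no room when three vertices are cut off at the cost of one and the
  rest is tight. The rest must then give up one vertex in return for a single dominated vertex; the
  set \<open>P\<close> of \<open>isolates\<close> expresses this, and the tight cases must be known
  exactly to prove it. So the induction carries their structure along, as the predicate
  \<open>blocks\<close>. Among the tight cases only the triangle gives up nothing, but there any
  vertex may be circled. The cycle lengths 5, 6 and 9 are those from 4 on for which a quarter,
  rounded up, is not below a third. Of the attachable graphs with a pentagon only
  \<open>H6 {1}\<close> occurs in a unicyclic graph, since a further neighbour of the circled vertex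
  creates another cycle.\<close>

definition dominates :: "('a \<Rightarrow> 'a) \<Rightarrow> 'a set \<Rightarrow> 'a \<Rightarrow> bool" where
  "dominates f D v \<longleftrightarrow> v \<in> D \<or> f v \<in> D \<or> v \<in> f ` D"

text \<open>The vertices in \<open>P\<close> count as dominated already.\<close>

definition isolates :: "('a \<Rightarrow> 'a) \<Rightarrow> 'a set \<Rightarrow> 'a set \<Rightarrow> 'a set \<Rightarrow> bool" where
  "isolates f V P D \<longleftrightarrow> D \<subseteq> V \<and>
     (\<forall>v\<in>V. v \<in> P \<or> f v \<in> P \<or> dominates f D v \<or> dominates f D (f v))"

lemma dominates_mono: "dominates f D v \<Longrightarrow> D \<subseteq> D' \<Longrightarrow> dominates f D' v"
  unfolding dominates_def by blast

text \<open>\<open>f\<close> permutes \<open>C\<close> in a single cycle of length \<open>k\<close>.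
  Since \<open>orbit\<close> and \<open>period\<close> hold from every point of \<open>C\<close>,
  later arguments may start their walk wherever it suits them.\<close>

locale cyclic_map =
  fixes f :: "'a \<Rightarrow> 'a" and C :: "'a set" and k :: nat
  assumes k_ge_3: "3 \<le> k"
    and card_C: "card C = k"
    and orbit: "c \<in> C \<Longrightarrow> (\<lambda>i. (f ^^ i) c) ` {..<k} = C"
    and period: "c \<in> C \<Longrightarrow> (f ^^ k) c = c"
begin

lemma finite_C: "finite C"
  using card_C k_ge_3 card.infinite by fastforce

lemma C_nonempty: "C \<noteq> {}"
  using card_C k_ge_3 by auto

lemma inj_orbit: "c \<in> C \<Longrightarrow> inj_on (\<lambda>i. (f ^^ i) c) {..<k}"
  by (rule eq_card_imp_inj_on) (simp_all add: orbit card_C)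

lemma funpow_in_C: "c \<in> C \<Longrightarrow> (f ^^ i) c \<in> C"
proof (induction i)
  case (Suc i)
  then have "(f ^^ 1) ((f ^^ i) c) \<in> (\<lambda>j. (f ^^ j) ((f ^^ i) c)) ` {..<k}"
    using k_ge_3 by (intro imageI) auto
  with Suc orbit show ?case by auto
qed simp

lemma f_in_C: "c \<in> C \<Longrightarrow> f c \<in> C"
  using funpow_in_C[of c 1] by simp

lemma funpow_eq_iff: "c \<in> C \<Longrightarrow> i < k \<Longrightarrow> j < k \<Longrightarrow> (f ^^ i) c = (f ^^ j) c \<longleftrightarrow> i = j"
  using inj_orbit by (auto dest: inj_onD)

lemma orbitE:
  assumes "c \<in> C" "v \<in> C"
  obtains i where "i < k" "v = (f ^^ i) c"
  using orbit[OF assms(1)] assms(2) by auto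

lemma f_neq: "c \<in> C \<Longrightarrow> f c \<noteq> c"
  using funpow_eq_iff[of c 1 0] k_ge_3 by simp

lemma preimage:
  assumes "c \<in> C"
  obtains p where "p \<in> C" "f p = c"
proof
  show "(f ^^ (k - 1)) c \<in> C" using funpow_in_C assms .
  have "f ((f ^^ (k - 1)) c) = (f ^^ Suc (k - 1)) c" by simp
  also have "Suc (k - 1) = k" using k_ge_3 by simp
  finally show "f ((f ^^ (k - 1)) c) = c" using period assms by simp
qed

lemma inj_on_C: "inj_on f C"
proof (rule eq_card_imp_inj_on)
  have "f ` C = C" using f_in_C preimage by blast
  then show "card (f ` C) = card C" by simp
qed (rule finite_C)

text \<open>On such a \<open>V\<close> the edges \<open>v\<close>, \<open>f v\<close> form a finite
  connected graph with cycle \<open>C\<close>. The induction keeps \<open>f\<close> and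
  \<open>C\<close> and shrinks only \<open>V\<close>.\<close>

definition admissible :: "'a set \<Rightarrow> bool" where
  "admissible V \<longleftrightarrow> finite V \<and> C \<subseteq> V \<and> f ` V \<subseteq> V \<and> (\<forall>v\<in>V. \<exists>m. (f ^^ m) v \<in> C)"

text \<open>
  The unicyclic members of \<^const>\<open>family_G\<close>, with the set of circled vertices: the cycle lies in a
  copy of \<open>C\<^sub>3\<close>, in a copy of \<open>H6 {1}\<close>, or in \<open>G0\<close>.
\<close>

inductive blocks :: "'a set \<Rightarrow> 'a set \<Rightarrow> bool" where
  triangle: "k = 3 \<Longrightarrow> c \<in> C \<Longrightarrow> blocks C {c}"
| lollipop: "k = 5 \<Longrightarrow> x \<notin> C \<Longrightarrow> f x \<in> C \<Longrightarrow> blocks (insert x C) {x}"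
| crown: "(\<And>c. c \<in> C \<Longrightarrow> f (g c) = c \<and> g c \<notin> C \<and> f (h c) = g c) \<Longrightarrow>
    blocks (C \<union> g ` C \<union> h ` C) C"
| hang: "blocks V R \<Longrightarrow> f x \<in> R \<Longrightarrow> f y = x \<Longrightarrow> f z = y \<Longrightarrow> x \<notin> V \<Longrightarrow> y \<notin> V \<Longrightarrow> z \<notin> V \<Longrightarrow>
    blocks (V \<union> {x, y, z}) (insert x R)"

section \<open>Sizes and small isolating sets of the extremal maps\<close>

lemma crown_card:
  assumes "\<And>c. c \<in> C \<Longrightarrow> f (g c) = c \<and> g c \<notin> C \<and> f (h c) = g c"
  shows "card (C \<union> g ` C \<union> h ` C) = 3 * k"
proof -
  have g: "inj_on g C" using assms by (metis inj_onI)
  have h: "inj_on h C" using assms by (metis inj_onI)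
  have "C \<inter> g ` C = {}" using assms by auto
  moreover have "(C \<union> g ` C) \<inter> h ` C = {}"
  proof -
    have "h c \<noteq> c' \<and> h c \<noteq> g c'" if "c \<in> C" "c' \<in> C" for c c'
      using assms[OF that(1)] assms[OF that(2)] f_in_C[OF that(2)] that(2) by auto
    then show ?thesis by auto
  qed
  ultimately  show ?thesis
    by (simp add: card_Un_disjoint finite_C card_image g h card_C)
qed

lemma blocks_basic:
  assumes "blocks V R"
  shows "finite V \<and> f ` V \<subseteq> V \<and> R \<subseteq> V \<and> C \<subseteq> V"
  using assms
proof induction
  case (crown g h)
  then have "f ` (C \<union> g ` C \<union> h ` C) \<subseteq> C \<union> g ` C \<union> h ` C" using f_in_C by auto
  then show ?case using finite_C by auto
qed (auto simp: finite_C f_in_C)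

lemma hang_card:
  assumes "blocks V R" "f x \<in> R" "f y = x" "f z = y" "x \<notin> V" "y \<notin> V" "z \<notin> V"
  shows "card (V \<union> {x, y, z}) = card V + 3" "x \<noteq> y" "x \<noteq> z" "y \<noteq> z"
proof -
  have *: "finite V" "f x \<in> V" using blocks_basic[OF assms(1)] assms(2) by auto
  show n: "x \<noteq> y" "x \<noteq> z" "y \<noteq> z" using assms * by metis+
  then have "card {x, y, z} = 3" by simp
  then show "card (V \<union> {x, y, z}) = card V + 3" using assms *
    by (subst card_Un_disjoint) auto
qed

text \<open>With the cycle spelled out, an isolating set of a short cycle can be checked vertex by
  vertex.\<close>

lemma five_cycle:
  assumes "k = 5" "c \<in> C"
  shows "C = {c, f c, f (f c), f (f (f c)), f (f (f (f c)))}" "f (f (f (f (f c)))) = c"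
proof -
  have "{..<5::nat} = {0, 1, 2, 3, 4}" by auto
  then show "C = {c, f c, f (f c), f (f (f c)), f (f (f (f c)))}"
    using orbit[OF assms(2)] assms(1) by (simp add: eval_nat_numeral)
  show "f (f (f (f (f c)))) = c" using period[OF assms(2)] assms(1) by (simp add: eval_nat_numeral)
qed

lemma six_cycle:
  assumes "k = 6" "c \<in> C"
  shows "C = {c, f c, f (f c), f (f (f c)), f (f (f (f c))), f (f (f (f (f c))))}"
    "f (f (f (f (f (f c))))) = c"
proof -
  have "{..<6::nat} = {0, 1, 2, 3, 4, 5}" by auto
  then show "C = {c, f c, f (f c), f (f (f c)), f (f (f (f c))), f (f (f (f (f c))))}"
    using orbit[OF assms(2)] assms(1) by (simp add: eval_nat_numeral)
  show "f (f (f (f (f (f c))))) = c" using period[OF assms(2)] assms(1) by (simp add: eval_nat_numeral)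
qed

lemma nine_cycle:
  assumes "k = 9" "c \<in> C"
  shows "C = {c, f c, f (f c), f (f (f c)), f (f (f (f c))), f (f (f (f (f c)))),
      f (f (f (f (f (f c))))), f (f (f (f (f (f (f c)))))), f (f (f (f (f (f (f (f c)))))))}"
    "f (f (f (f (f (f (f (f (f c)))))))) = c"
proof -
  have "{..<9::nat} = {0, 1, 2, 3, 4, 5, 6, 7, 8}" by auto
  then show "C = {c, f c, f (f c), f (f (f c)), f (f (f (f c))), f (f (f (f (f c)))),
      f (f (f (f (f (f c))))), f (f (f (f (f (f (f c)))))), f (f (f (f (f (f (f (f c)))))))}"
    using orbit[OF assms(2)] assms(1) by (simp add: eval_nat_numeral)
  show "f (f (f (f (f (f (f (f (f c)))))))) = c"
    using period[OF assms(2)] assms(1) by (simp add: eval_nat_numeral)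
qed

text \<open>Having all roots in \<open>D\<close> makes it reusable in \<open>blocks_saving\<close>:
  when a path \<open>x\<close>, \<open>y\<close>, \<open>z\<close> is hung at a root,
  \<open>D\<close> already dominates \<open>x\<close>, and only the edge between \<open>y\<close>
  and \<open>z\<close> is left.\<close>

lemma blocks_isolating_roots:
  assumes "blocks V R"
  shows "\<exists>D. R \<subseteq> D \<and> isolates f V {} D \<and> 3 * card D \<le> card V"
  using assms
proof induction
  case (triangle c)
  have "dominates f {c} (f v) \<or> dominates f {c} v" if "v \<in> C" for v
  proof -
    have "{..<3::nat} = {0, 1, 2}" by auto
    then have "C = {c, f c, f (f c)}" "f (f (f c)) = c"
      using orbit[OF triangle(2)] period[OF triangle(2)] triangle(1)
      by (simp_all add: eval_nat_numeral)
    with that show ?thesis by (auto simp: dominates_def)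
  qed
  then show ?case using triangle card_C by (intro exI[of _ "{c}"]) (auto simp: isolates_def)
next
  case (lollipop x)
  let ?c = "f x"
  have "isolates f (insert x C) {} {x, f (f ?c)}"
    using five_cycle[OF lollipop(1,3)] by (auto simp: isolates_def dominates_def)
  moreover have "card {x, f (f ?c)} \<le> 2" by (simp add: card_insert_if)
  ultimately show ?case
    using lollipop finite_C card_C by (intro exI[of _ "{x, f (f ?c)}"]) auto
next
  case (crown g h)
  then have "isolates f (C \<union> g ` C \<union> h ` C) {} C"
    by (auto simp: isolates_def dominates_def)
  then show ?case using crown_card[of g h] crown card_C by (intro exI[of _ C]) auto
next
  case (hang V R x y z)
  from hang.IH obtain D where D: "R \<subseteq> D" "isolates f V {} D" "3 * card D \<le> card V" by blast
  have "isolates f (V \<union> {x, y, z}) {} (insert x D)"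
    using D hang.hyps unfolding isolates_def dominates_def by auto
  moreover have "card (insert x D) \<le> Suc (card D)" by (rule card_insert_le_m1) auto
  ultimately show ?case using D hang_card(1)[OF hang.hyps]
    by (intro exI[of _ "insert x D"]) auto
qed

text \<open>If a new neighbour dominates a vertex \<open>y\<close> that is not a root, one vertex can be saved.\<close>

lemma blocks_saving:
  assumes "blocks V R" "y \<in> V" "y \<notin> R" "card V \<noteq> 3"
  shows "\<exists>D. isolates f V {y} D \<and> 3 * card D + 3 \<le> card V"
  using assms
proof (induction arbitrary: y)
  case (triangle c)
  then show ?case using card_C by auto
next
  case (lollipop x)
  let ?c = "f x"
  note five = five_cycle[OF lollipop(1,3)]
  from lollipop five consider "y = ?c" | "y = f ?c" | "y = f (f ?c)" | "y = f (f (f ?c))"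
    | "y = f (f (f (f ?c)))" by auto
  \<comment> \<open>Deleting \<open>y\<close> from the pentagon with its pendant vertex leaves a
    forest, and in each of the five positions one vertex dominates an end of each remaining
    edge.\<close>
  then have "\<exists>d. isolates f (insert x C) {y} {d}"
  proof cases
    case 1 then show ?thesis
      using five by (intro exI[of _ "f (f ?c)"]) (auto simp: isolates_def dominates_def)
  next
    case 2 then show ?thesis
      using five by (intro exI[of _ "f (f (f (f ?c)))"]) (auto simp: isolates_def dominates_def)
  next
    case 3 then show ?thesis
      using five by (intro exI[of _ "?c"]) (auto simp: isolates_def dominates_def)
  next
    case 4 then show ?thesis
      using five by (intro exI[of _ "?c"]) (auto simp: isolates_def dominates_def)
  next
    case 5 then show ?thesis
      using five by (intro exI[of _ "f ?c"]) (auto simp: isolates_def dominates_def)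
  qed
  then obtain d where "isolates f (insert x C) {y} {d}" ..
  then show ?case using lollipop finite_C card_C by (intro exI[of _ "{d}"]) auto
next
  case (crown g h)
  then obtain c where c: "c \<in> C" "y = g c \<or> y = h c" by auto
  \<comment> \<open>\<open>c\<close> is the root of the path containing \<open>y\<close>. It can be
    spared: its neighbour \<open>f c\<close> still dominates it, and the edge between
    \<open>g c\<close> and \<open>h c\<close> meets \<open>y\<close>.\<close>
  let ?D = "C - {c}"
  have dom: "dominates f ?D v" if "v \<in> C" for v
    using that f_in_C[OF that] f_neq[OF that] by (cases "v = c") (auto simp: dominates_def)
  have "v \<in> {y} \<or> f v \<in> {y} \<or> dominates f ?D v \<or> dominates f ?D (f v)"
    if v: "v \<in> C \<union> g ` C \<union> h ` C" for v
  proof -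
    from v consider "v \<in> C" | "v \<in> g ` C" | c' where "c' \<in> C" "v = h c'" by auto
    then show ?thesis
    proof cases
      case 3
      then have "f v = g c'" "f (f v) = c'" using crown.hyps by auto
      then show ?thesis using 3 c by (cases "c' = c") (auto simp: dominates_def)
    qed (use dom crown.hyps in auto)
  qed
  then have "isolates f (C \<union> g ` C \<union> h ` C) {y} ?D" unfolding isolates_def by blast
  moreover have "card ?D = k - 1" using c card_C by simp
  ultimately show ?case using crown_card[of g h] crown.hyps k_ge_3
    by (intro exI[of _ ?D]) auto
next
  case (hang V R x y' z)
  note card = hang_card[OF hang.hyps] and basic = blocks_basic[OF hang.hyps(1)]
  show ?case
  proof (cases "y \<in> V")
    case False
    then have y: "y = y' \<or> y = z" using hang by auto
    obtain D where D: "R \<subseteq> D" "isolates f V {} D" "3 * card D \<le> card V"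
      using blocks_isolating_roots hang.hyps(1) by blast
    have "isolates f (V \<union> {x, y', z}) {y} D"
      using D hang.hyps y unfolding isolates_def dominates_def by auto
    then show ?thesis using D card by auto
  next
    case True
    show ?thesis
    proof (cases "card V = 3")
      case V: False
      then obtain D where D: "isolates f V {y} D" "3 * card D + 3 \<le> card V"
        using hang.IH[OF True] hang.prems by auto
      have "isolates f (V \<union> {x, y', z}) {y} (insert x D)"
        using D hang.hyps unfolding isolates_def dominates_def by auto
      moreover have "card (insert x D) \<le> Suc (card D)" by (rule card_insert_le_m1) auto
      ultimately show ?thesis using D card by (intro exI[of _ "insert x D"]) auto
    next
      \<comment> \<open>Now \<open>V\<close> is a triangle, to which the induction hypothesis does
        not apply. As \<open>y\<close> and \<open>f x\<close> are two distinct vertices of it, each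
        of its edges meets one of them, so \<open>x\<close> alone suffices.\<close>
      case V: True
      have fx: "f x \<in> V" "f x \<noteq> y" using basic hang.hyps hang.prems by auto
      have "V = C" using V basic card_C k_ge_3 by (metis card_seteq)
      have "v = y \<or> f v = y \<or> dominates f {x} v \<or> dominates f {x} (f v)" if "v \<in> V" for v
      proof (rule ccontr)
        assume *: "\<not> ?thesis"
        then have "v \<noteq> y" "f v \<noteq> y" "v \<noteq> f x" "f v \<noteq> f x" by (auto simp: dominates_def)
        moreover have "f v \<noteq> v" using f_neq that \<open>V = C\<close> by simp
        ultimately have "card {v, f v, y, f x} = 4" using fx by auto
        moreover have "{v, f v, y, f x} \<subseteq> V" using that True fx basic by auto
        ultimately show False using V basic by (metis card_mono numeral_le_iff semiring_norm(69,72))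
      qed
      then have "isolates f (V \<union> {x, y', z}) {y} {x}"
        using hang.hyps unfolding isolates_def by (auto simp: dominates_def)
      then show ?thesis using card V by (intro exI[of _ "{x}"]) auto
    qed
  qed
qed

text \<open>A dominated vertex settles its two edges and a chosen one settles four consecutive
  edges. So besides \<open>y\<close> one vertex is enough for six edges (2 + 4) and two are enough
  for nine (2 + 4 + 4), one less than a third of the length.\<close>

lemma cycle_saving:
  assumes "k = 6 \<or> k = 9" "y \<in> C"
  shows "\<exists>D. isolates f C {y} D \<and> 3 * card D + 3 \<le> card C"
  using assms(1)
proof
  assume k: "k = 6"
  then have "isolates f C {y} {f (f (f y))}"
    using six_cycle[OF k assms(2)] by (auto simp: isolates_def dominates_def)
  then show ?thesis using k card_C by (intro exI[of _ "{f (f (f y))}"]) simp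
next
  assume k: "k = 9"
  let ?D = "{f (f (f y)), f (f (f (f (f (f (f y))))))}"
  have "isolates f C {y} ?D"
    using nine_cycle[OF k assms(2)] by (auto simp: isolates_def dominates_def)
  moreover have "card ?D \<le> 2" by (simp add: card_insert_if)
  ultimately show ?thesis using k card_C by (intro exI[of _ ?D]) simp
qed

end

section \<open>Height at most two\<close>

lemma dominates_funpow:
  assumes "D = (\<lambda>i. (f ^^ i) c) ` I"
  shows "i \<in> I \<Longrightarrow> dominates f D ((f ^^ i) c)"
    and "Suc i \<in> I \<Longrightarrow> dominates f D ((f ^^ i) c)"
    and "i \<in> I \<Longrightarrow> dominates f D ((f ^^ Suc i) c)"
  unfolding assms dominates_def by (auto intro: image_eqI[of _ _ "Suc i"])

locale shallow_cyclic_map = cyclic_map +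
  fixes V :: "'a set"
  assumes admissible: "admissible V"
    and depth: "v \<in> V \<Longrightarrow> v \<in> C \<or> f v \<in> C \<or> f (f v) \<in> C"
begin

definition tree :: "'a \<Rightarrow> 'a set" where
  "tree c = {v \<in> V. v = c \<or> v \<notin> C \<and> (f v = c \<or> f v \<notin> C \<and> f (f v) = c)}"

text \<open>The isolating sets built for shallow maps lie in \<open>C\<close>, and such a set
  dominates an end of an edge with both ends off the cycle only if it contains the cycle vertex next
  to that edge. These are the vertices forced in this way.\<close>

definition deep :: "'a set" where
  "deep = {c \<in> C. \<exists>v\<in>V. v \<notin> C \<and> f v \<notin> C \<and> f (f v) = c}"

lemma finite_V: "finite V" and C_subset: "C \<subseteq> V" and f_in_V: "v \<in> V \<Longrightarrow> f v \<in> V"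
  using admissible by (auto simp: admissible_def)

lemma finite_tree: "finite (tree c)"
  using finite_V by (auto simp: tree_def)

lemma V_eq_trees: "V = (\<Union>c\<in>C. tree c)"
proof
  show "V \<subseteq> (\<Union>c\<in>C. tree c)"
  proof
    fix v assume v: "v \<in> V"
    then have "v \<notin> C \<Longrightarrow> v \<in> tree (f v)" "v \<notin> C \<Longrightarrow> f v \<notin> C \<Longrightarrow> v \<in> tree (f (f v))" "v \<in> tree v"
      by (auto simp: tree_def)
    then show "v \<in> (\<Union>c\<in>C. tree c)" using depth[OF v] by blast
  qed
qed (auto simp: tree_def)

lemma card_V: "card V = (\<Sum>c\<in>C. card (tree c))"
proof -
  have "\<forall>c\<in>C. \<forall>d\<in>C. c \<noteq> d \<longrightarrow> tree c \<inter> tree d = {}" by (auto simp: tree_def)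
  then show ?thesis using card_UN_disjoint[of C tree] finite_C finite_tree V_eq_trees by simp
qed

lemma card_V_orbit: "c \<in> C \<Longrightarrow> card V = (\<Sum>i<k. card (tree ((f ^^ i) c)))"
  using card_V sum.reindex[OF inj_orbit, of c "\<lambda>c. card (tree c)"] orbit[of c] by (simp add: o_def)

lemma tree_ge_1: "c \<in> C \<Longrightarrow> 1 \<le> card (tree c)"
  using card_mono[OF finite_tree, of "{c}" c] C_subset by (auto simp: tree_def)

lemma tree_ge_2: "v \<in> V \<Longrightarrow> v \<notin> C \<Longrightarrow> f v \<in> C \<Longrightarrow> 2 \<le> card (tree (f v))"
  using card_mono[OF finite_tree, of "{v, f v}" "f v"] f_in_V
  by (cases "v = f v") (auto simp: tree_def)

lemma tree_deep: "v \<in> V \<Longrightarrow> v \<notin> C \<Longrightarrow> f v \<notin> C \<Longrightarrow> {v, f v, f (f v)} \<subseteq> tree (f (f v))"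
  using f_in_V depth by (auto simp: tree_def)

lemma card_deep:
  assumes "v \<in> V" "v \<notin> C" "f v \<notin> C"
  shows "card {v, f v, f (f v)} = 3"
proof -
  have c: "f (f v) \<in> C" using depth assms by blast
  then have "f (f (f v)) \<in> C" by (rule f_in_C)
  then have "v \<noteq> f v" "v \<noteq> f (f v)" "f v \<noteq> f (f v)" using assms c by metis+
  then show ?thesis by simp
qed

lemma tree_ge_3: "c \<in> deep \<Longrightarrow> 3 \<le> card (tree c)"
  using card_mono[OF finite_tree tree_deep] card_deep by (fastforce simp: deep_def)

lemma isolatesI:
  assumes "D \<subseteq> C" "deep \<subseteq> D"
    and "\<And>c. c \<in> C \<Longrightarrow> dominates f D c \<or> dominates f D (f c)"
    and "\<And>v. v \<in> V \<Longrightarrow> v \<notin> C \<Longrightarrow> f v \<in> C \<Longrightarrow> dominates f D (f v)"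
  shows "isolates f V {} D"
proof -
  have "dominates f D v \<or> dominates f D (f v)" if v: "v \<in> V" for v
  proof (cases "v \<in> C \<or> f v \<in> C")
    case True
    with assms(3,4) v show ?thesis by blast
  next
    case False
    then have "f (f v) \<in> D" using depth v assms(2) by (auto simp: deep_def)
    then show ?thesis by (simp add: dominates_def)
  qed
  then show ?thesis using assms(1) C_subset by (auto simp: isolates_def)
qed

lemma isolatesI_orbit:
  assumes "c \<in> C" "deep \<subseteq> D" "D \<subseteq> C"
    and "\<And>i. i < k \<Longrightarrow> dominates f D ((f ^^ i) c)"
  shows "isolates f V {} D"
proof (rule isolatesI[OF assms(3,2)])
  fix d assume "d \<in> C"
  then show "dominates f D d \<or> dominates f D (f d)" using assms(1,4) orbitE by metis
next
  fix v assume "f v \<in> C"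
  then show "dominates f D (f v)" using assms(1,4) orbitE by metis
qed

text \<open>Here \<open>C\<close> itself isolates, with \<open>k\<close> vertices. Every tree has at
  least three vertices, so \<open>card V\<close> is at least \<open>3 * k\<close>, and equality
  forces every tree to be a three-vertex path ending at its cycle vertex, which is the
  crown.\<close>

lemma all_deep:
  assumes "deep = C"
  shows "(\<exists>D. isolates f V {} D \<and> 3 * card D < card V) \<or> blocks V C"
proof (cases "3 * k < card V")
  case True
  have "isolates f V {} C"
    by (rule isolatesI) (auto simp: assms dominates_def)
  then show ?thesis using True card_C by blast
next
  case False
  have "card (tree c) = 3" if c: "c \<in> C" for c
  proof (rule ccontr)
    assume "card (tree c) \<noteq> 3"
    then have "3 < card (tree c)" using tree_ge_3[of c] c assms by simp
    then have "(\<Sum>c\<in>C. 3) < (\<Sum>c\<in>C. card (tree c))"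
      using tree_ge_3 c assms finite_C by (intro sum_strict_mono_ex1) auto
    then show False using False card_V card_C by simp
  qed
  then have tree: "tree (f (f v)) = {v, f v, f (f v)}"
    if "v \<in> V" "v \<notin> C" "f v \<notin> C" for v
    using that tree_deep[OF that] card_deep[OF that] card_subset_eq[OF finite_tree] depth by metis
  obtain h where h: "\<And>c. c \<in> C \<Longrightarrow> h c \<in> V \<and> h c \<notin> C \<and> f (h c) \<notin> C \<and> f (f (h c)) = c"
    using assms unfolding deep_def by (auto simp: set_eq_iff) metis
  let ?g = "\<lambda>c. f (h c)"
  have "tree c = {h c, ?g c, c}" if "c \<in> C" for c
    using tree[of "h c"] h[OF that] by simp
  then have V: "V = C \<union> ?g ` C \<union> h ` C" using V_eq_trees by auto
  have "blocks (C \<union> ?g ` C \<union> h ` C) C" by (rule blocks.crown) (use h in auto)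
  then show ?thesis using V by simp
qed

text \<open>
  Walking along the cycle from a deep vertex, take the deep vertices and every vertex at distance
  three from the last one taken; \<open>phase\<close> is the distance to the last vertex taken.
\<close>

primrec phase :: "'a \<Rightarrow> nat \<Rightarrow> nat" where
  "phase c 0 = 0"
| "phase c (Suc i) =
    (if (f ^^ Suc i) c \<in> deep \<or> phase c i = 2 then 0 else Suc (phase c i))"

lemma phase_le: "phase c i \<le> 2"
  by (induction i) auto

text \<open>Three vertices pay for each vertex taken: a deep one is paid for by its own tree, any
  other by itself and the two positions before it. \<open>phase c i\<close> is the credit not yet
  spent.\<close>

lemma phase_card:
  assumes "c \<in> deep"
  shows "3 * card {j. j \<le> i \<and> phase c j = 0} + phase c i \<le> (\<Sum>j\<le>i. card (tree ((f ^^ j) c)))"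
proof (induction i)
  case 0
  have "{j. j \<le> 0 \<and> phase c j = 0} = {0}" by auto
  then show ?case using tree_ge_3[OF assms] by simp
next
  case (Suc i)
  let ?I = "\<lambda>i. {j. j \<le> i \<and> phase c j = 0}"
  have C: "(f ^^ Suc i) c \<in> C" using assms funpow_in_C by (auto simp: deep_def simp del: funpow.simps)
  note ge1 = tree_ge_1[OF C]
  show ?case
  proof (cases "phase c (Suc i) = 0")
    case True
    have "?I (Suc i) = insert (Suc i) (?I i)" using True by (auto simp: le_Suc_eq)
    then have "card (?I (Suc i)) = Suc (card (?I i))" by simp
    moreover have "(f ^^ Suc i) c \<in> deep \<or> phase c i = 2" using True by (auto split: if_splits)
    ultimately show ?thesis using Suc ge1 tree_ge_3[of "(f ^^ Suc i) c"] True
      by (auto simp del: funpow.simps)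
  next
    case False
    then have "?I (Suc i) = ?I i" by (auto simp: le_Suc_eq simp del: phase.simps(2))
    moreover have "phase c (Suc i) = Suc (phase c i)" using False by (auto split: if_splits)
    ultimately show ?thesis using Suc ge1 by (simp del: funpow.simps phase.simps(2))
  qed
qed

text \<open>Phase 0 means taken, phase 1 means next after a taken vertex, and phase 2 is always
  followed by phase 0; only in the last case must the next position still lie in the range.\<close>

lemma phase_dominates:
  assumes "D = (\<lambda>j. (f ^^ j) c) ` {j. j \<le> m \<and> phase c j = 0}" "i \<le> m" "phase c i = 2 \<Longrightarrow> i < m"
  shows "dominates f D ((f ^^ i) c)"
proof -
  consider "phase c i = 0" | "phase c i = 1" | "phase c i = 2" using phase_le[of c i] by linarith
  then show ?thesis
  proof cases
    case 1
    then show ?thesis using assms(2) by (intro dominates_funpow(1)[OF assms(1)]) auto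
  next
    case 2
    then obtain j where j: "i = Suc j" "phase c j = 0" by (cases i) (auto split: if_splits)
    then show ?thesis
      using assms(2) dominates_funpow(3)[OF assms(1), of j] by (simp del: funpow.simps)
  next
    case 3
    then show ?thesis using assms(3) by (intro dominates_funpow(2)[OF assms(1)]) auto
  qed
qed

text \<open>The walk starts at a deep vertex \<open>c\<close> whose predecessor \<open>d\<close> is
  not deep, so that \<open>d\<close>, the last vertex, is dominated by \<open>c\<close> anyway. The
  bound of \<open>phase_card\<close> then becomes strict: either credit is left at the end, or a
  larger tree just before \<open>d\<close> gives a surplus, or \<open>d\<close> need not be
  taken.\<close>

lemma some_deep:
  assumes "deep \<noteq> {}" "deep \<noteq> C"
  shows "\<exists>D. isolates f V {} D \<and> 3 * card D < card V"
proof -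
  have "\<exists>d. d \<in> C \<and> d \<notin> deep \<and> f d \<in> deep"
  proof (rule ccontr)
    assume *: "\<not> ?thesis"
    \<comment> \<open>Otherwise not being deep would pass from each cycle vertex to the next and so
      spread over all of \<open>C\<close>.\<close>
    have step: "f c \<notin> deep" if "c \<in> C" "c \<notin> deep" for c using * that by auto
    obtain c where c: "c \<in> C" "c \<notin> deep" using assms by (auto simp: deep_def)
    have "(f ^^ i) c \<notin> deep" for i
      by (induction i) (use c step funpow_in_C[of c] in auto)
    moreover obtain a where "a \<in> deep" "a \<in> C" using assms(1) by (auto simp: deep_def)
    ultimately show False using c orbitE by metis
  qed
  then obtain d where d: "d \<in> C" "d \<notin> deep" "f d \<in> deep" by blast
  define c where "c = f d"
  have c: "c \<in> deep" "c \<in> C" using d by (auto simp: c_def deep_def)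
  \<comment> \<open>With \<open>k = m + 3\<close> the last three positions are \<open>m\<close>,
    \<open>m + 1\<close> and \<open>m + 2\<close>, and \<open>d\<close> is at the last of
    them.\<close>
  obtain m where k: "k = Suc (Suc (Suc m))" using k_ge_3
    by (metis Suc_le_D numeral_3_eq_3 Suc_le_mono)
  have d_eq: "d = (f ^^ Suc (Suc m)) c"
  proof (rule inj_onD[OF inj_on_C])
    show "f d = f ((f ^^ Suc (Suc m)) c)" using period[OF c(2)] k by (simp add: c_def)
  qed (use d funpow_in_C c in \<open>simp_all del: funpow.simps\<close>)
  have total: "card V = (\<Sum>j\<le>Suc (Suc m). card (tree ((f ^^ j) c)))"
    using card_V_orbit[OF c(2)] k by (simp add: lessThan_Suc_atMost del: sum.lessThan_Suc sum.atMost_Suc funpow.simps)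
  let ?I = "\<lambda>n. {j. j \<le> n \<and> phase c j = 0}"
  let ?D = "\<lambda>n. (\<lambda>j. (f ^^ j) c) ` ?I n"
  have zero: "c \<in> ?D n" for n by (auto intro!: image_eqI[of _ _ 0])
  have wrap: "f ((f ^^ Suc (Suc m)) c) = c" using d_eq c_def by simp
  have card_D: "card (?D n) \<le> card (?I n)" for n by (rule card_image_le) auto
  have in_C: "?D n \<subseteq> C" for n using funpow_in_C c by auto
  have deep_phase: "phase c j = 0" if "(f ^^ j) c \<in> deep" for j
    using that by (cases j) auto
  show ?thesis
  proof (cases "phase c (Suc (Suc m)) = 0 \<and> card (tree ((f ^^ Suc m) c)) = 1")
    case False
    have "isolates f V {} (?D (Suc (Suc m)))"
    proof (rule isolatesI_orbit[OF c(2)])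
      show "deep \<subseteq> ?D (Suc (Suc m))"
      proof
        fix a assume a: "a \<in> deep"
        then obtain i where "i < k" "a = (f ^^ i) c" using orbitE[OF c(2), of a] by (auto simp: deep_def)
        then show "a \<in> ?D (Suc (Suc m))" using a deep_phase k by auto
      qed
      fix i assume i: "i < k"
      show "dominates f (?D (Suc (Suc m))) ((f ^^ i) c)"
      proof (cases "i = Suc (Suc m)")
        case True
        then show ?thesis using wrap zero by (auto simp: dominates_def simp del: funpow.simps)
      next
        case False
        then show ?thesis using i k by (intro phase_dominates[where m = "Suc (Suc m)"]) auto
      qed
    qed (use in_C in auto)
    moreover have "3 * card (?I (Suc (Suc m))) < card V"
    proof (cases "phase c (Suc (Suc m)) = 0")
      case False
      then show ?thesis using phase_card[OF c(1), of "Suc (Suc m)"] total by linarith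
    next
      case True
      then have p1: "phase c (Suc m) = 2" using d d_eq by (auto split: if_splits)
      then have p0: "phase c m = 1" by (auto split: if_splits)
      have "?I (Suc (Suc m)) = insert (Suc (Suc m)) (?I m)"
        using True p1 by (auto simp: le_Suc_eq simp del: phase.simps(2))
      then have I: "card (?I (Suc (Suc m))) = Suc (card (?I m))" by simp
      have C: "(f ^^ Suc m) c \<in> C" "(f ^^ Suc (Suc m)) c \<in> C" using funpow_in_C c by blast+
      \<comment> \<open>\<open>d\<close> is paid for by the credit 1 at \<open>m\<close> and the
        last two trees: 1 + 2 + 1 exceeds the three needed.\<close>
      have "2 \<le> card (tree ((f ^^ Suc m) c))" using False True tree_ge_1[OF C(1)] by linarith
      moreover note tree_ge_1[OF C(2)]
      ultimately show ?thesis using phase_card[OF c(1), of m] p0 I total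
        by (simp del: funpow.simps)
    qed
    ultimately show ?thesis using card_D[of "Suc (Suc m)"] by (meson le_less_trans mult_le_mono2)
  next
    \<comment> \<open>\<open>d\<close> was taken only because of its phase, and its predecessor has
      a trivial tree. Stopping at \<open>m\<close> suffices: \<open>c\<close> dominates
      \<open>d\<close>, and the predecessor may stay undominated.\<close>
    case True
    then have p1: "phase c (Suc m) = 2" using d d_eq by (auto split: if_splits)
    then have p0: "phase c m = 1" by (auto split: if_splits)
    have cases: "i \<le> m \<or> i = Suc m \<or> i = Suc (Suc m)" if "i < k" for i using that k by auto
    have dom: "dominates f (?D m) ((f ^^ i) c)" if "i < k" "i \<noteq> Suc m" for i
    proof (cases "i = Suc (Suc m)")
      case True
      then show ?thesis using wrap zero by (auto simp: dominates_def simp del: funpow.simps)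
    next
      case False
      then show ?thesis using that cases[OF that(1)] p0
        by (intro phase_dominates[where m = m]) (auto simp: le_less)
    qed
    have "isolates f V {} (?D m)"
    proof (rule isolatesI)
      show "deep \<subseteq> ?D m"
      proof
        fix a assume a: "a \<in> deep"
        then obtain i where i: "i < k" "a = (f ^^ i) c" using orbitE[OF c(2), of a] by (auto simp: deep_def)
        with a have p: "phase c i = 0" using deep_phase by blast
        have "i \<noteq> Suc m" using p p1 by auto
        moreover have "i \<noteq> Suc (Suc m)" using i a d d_eq by auto
        ultimately show "a \<in> ?D m" using p i cases by auto
      qed
    next
      fix a assume "a \<in> C"
      then obtain i where i: "i < k" "a = (f ^^ i) c" using orbitE[OF c(2)] by auto
      have "f ((f ^^ Suc m) c) = (f ^^ Suc (Suc m)) c" by simp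
      then show "dominates f (?D m) a \<or> dominates f (?D m) (f a)"
        using i dom[of i] dom[of "Suc (Suc m)"] k by (cases "i = Suc m") (auto simp del: funpow.simps)
    next
      fix v assume v: "v \<in> V" "v \<notin> C" "f v \<in> C"
      then obtain i where i: "i < k" "f v = (f ^^ i) c" using orbitE[OF c(2)] by auto
      have "i \<noteq> Suc m" using tree_ge_2[OF v] i True by auto
      then show "dominates f (?D m) (f v)" using i dom by simp
    qed (rule in_C)
    moreover have "3 * card (?I m) < card V"
      using phase_card[OF c(1), of m] p0 total by simp
    ultimately show ?thesis using card_D[of m] by (meson le_less_trans mult_le_mono2)
  qed
qed

end

section \<open>Maps with all vertices on the cycle or next to it\<close>

lemma third_cases: "\<exists>q. i = 3 * q \<or> i = 3 * q + 1 \<or> i = 3 * q + 2" for i :: nat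
  by presburger

context shallow_cyclic_map
begin

text \<open>An undominated position with a trivial tree only has its two cycle edges to be settled.
  Looking one step ahead is enough, since the entering edge is treated at the preceding
  position.\<close>

lemma orbit_selection:
  assumes "c \<in> C" "finite I" "deep = {}"
    and "\<And>i. i < k \<Longrightarrow>
      dominates f ((\<lambda>i. (f ^^ i) c) ` I) ((f ^^ i) c) \<or>
      dominates f ((\<lambda>i. (f ^^ i) c) ` I) ((f ^^ Suc i) c) \<and> card (tree ((f ^^ i) c)) = 1"
    and "3 * card I < card V"
  shows "\<exists>D. isolates f V {} D \<and> 3 * card D < card V"
proof -
  let ?D = "(\<lambda>i. (f ^^ i) c) ` I"
  have "isolates f V {} ?D"
  proof (rule isolatesI)
    show "?D \<subseteq> C" using funpow_in_C assms(1) by auto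
  next
    fix d assume "d \<in> C"
    then obtain i where "i < k" "d = (f ^^ i) c" using orbitE assms(1) by blast
    then show "dominates f ?D d \<or> dominates f ?D (f d)" using assms(4)[of i] by auto
  next
    fix v assume v: "v \<in> V" "v \<notin> C" "f v \<in> C"
    then obtain i where i: "i < k" "f v = (f ^^ i) c" using orbitE assms(1) by blast
    then have "card (tree ((f ^^ i) c)) \<noteq> 1" using tree_ge_2[OF v] by auto
    then show "dominates f ?D (f v)" using assms(4)[of i] i by auto
  qed (simp add: assms(3))
  moreover have "card ?D \<le> card I" using assms(2) by (rule card_image_le)
  ultimately show ?thesis using assms(5) by (meson le_less_trans mult_le_mono2)
qed

text \<open>Choosing every fourth vertex leaves no two consecutive vertices undominated. This takes
  k/4 vertices, rounded up, and three times that is less than \<open>k\<close> except for the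
  lengths 3, 5, 6 and 9; length 3 is the triangle.\<close>

lemma pure_cycle:
  assumes "V = C"
  shows "k \<in> {5, 6, 9} \<or> (\<exists>D. isolates f V {} D \<and> 3 * card D < card V) \<or> (\<exists>R. blocks V R)"
proof -
  obtain c where c: "c \<in> C" using C_nonempty by auto
  have deep: "deep = {}" unfolding deep_def using assms by auto
  have tree: "card (tree d) = 1" if "d \<in> C" for d
  proof -
    have "tree d = {d}" unfolding tree_def using assms that by auto
    then show ?thesis by simp
  qed
  consider "k = 3" | "k \<in> {5, 6, 9}" | "k = 4 \<or> k = 7 \<or> k = 8 \<or> 10 \<le> k" using k_ge_3 by force
  then show ?thesis
  proof cases
    case 1
    then show ?thesis using blocks.triangle[OF 1 c] assms by blast
  next
    case 3
    let ?n = "(k + 3) div 4"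
    let ?I = "(\<lambda>i. 4 * i) ` {..<?n}"
    let ?D = "(\<lambda>i. (f ^^ i) c) ` ?I"
    have in_I: "i \<in> ?I" if "i < k" "i mod 4 = 0" for i
    proof (rule image_eqI)
      show "i = 4 * (i div 4)" using that(2) by auto
      show "i div 4 \<in> {..<?n}" using that by simp
    qed
    have zero: "c \<in> ?D" using imageI[OF in_I[of 0], of "\<lambda>i. (f ^^ i) c"] k_ge_3 by simp
    \<comment> \<open>The disjunct \<open>Suc i = k\<close> is the wrap-around: the last position is
      next to the chosen vertex \<open>c\<close>, whatever its residue.\<close>
    have dom: "dominates f ?D ((f ^^ i) c)" if i: "i < k" "i mod 4 = 0 \<or> i mod 4 = 1 \<or> i mod 4 = 3 \<or> Suc i = k" for i
    proof -
      from i have "Suc i = k \<or> i mod 4 = 0 \<or> i mod 4 = 1 \<or> i mod 4 = 3 \<and> Suc i < k" by auto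
      then consider "Suc i = k" | "i mod 4 = 0" | "i mod 4 = 1" | "i mod 4 = 3" "Suc i < k" by metis
      then show ?thesis
      proof cases
        case 1
        then have "f ((f ^^ i) c) = c" using period[OF c] by auto
        then show ?thesis using zero unfolding dominates_def by simp
      next
        case 2
        then show ?thesis by (intro dominates_funpow(1)[OF refl] in_I i)
      next
        case 3
        then obtain j where j: "i = Suc j" by (cases i) auto
        then have "j mod 4 = 0" using 3 by presburger
        then show ?thesis unfolding j using i j by (intro dominates_funpow(3)[OF refl] in_I) auto
      next
        case 4
        then have "Suc i mod 4 = 0" by presburger
        with 4 show ?thesis by (intro dominates_funpow(2)[OF refl] in_I)
      qed
    qed
    have "\<exists>D. isolates f V {} D \<and> 3 * card D < card V"
    proof (rule orbit_selection[OF c _ deep, where I = ?I])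
      fix i assume i: "i < k"
      show "dominates f ?D ((f ^^ i) c) \<or> dominates f ?D ((f ^^ Suc i) c) \<and> card (tree ((f ^^ i) c)) = 1"
      proof (cases "i mod 4 = 2 \<and> Suc i \<noteq> k")
        case False
        then show ?thesis using dom[OF i] mod_exhaust_less_4[of i] by blast
      next
        case True
        then have "Suc i mod 4 = 3" by presburger
        then have "dominates f ?D ((f ^^ Suc i) c)" using dom[of "Suc i"] True i by simp
        then show ?thesis using tree funpow_in_C[OF c] by blast
      qed
    next
      have "card ?I \<le> ?n" using card_image_le[of "{..<?n}" "\<lambda>i. 4 * i"] by simp
      moreover have "3 * ?n < k" using 3 by presburger
      ultimately show "3 * card ?I < card V" unfolding assms card_C by linarith
    qed simp
    then show ?thesis by blast
  qed blast
qed

lemma card_V_ge: "C \<subset> V \<Longrightarrow> k < card V"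
  using psubset_card_mono[OF finite_V, of C] card_C by simp

text \<open>Every third position dominates the whole cycle, also when the last gap is shorter, so it
  does not matter where the pendant vertices hang.\<close>

lemma every_third:
  assumes "deep = {}" "c \<in> C" "k \<le> 3 * n" "3 * n < card V"
  shows "\<exists>D. isolates f V {} D \<and> 3 * card D < card V"
proof -
  let ?I = "(\<lambda>i. 3 * i) ` {..<n}"
  let ?D = "(\<lambda>i. (f ^^ i) c) ` ?I"
  have I: "3 * j \<in> ?I" if "j < n" for j using that by simp
  show ?thesis
  proof (rule orbit_selection[OF assms(2) _ assms(1), where I = ?I])
    fix i assume i: "i < k"
    obtain q where q: "i = 3 * q \<or> i = 3 * q + 1 \<or> i = 3 * q + 2"
      using third_cases by blast
    have j: "q < n" using q i assms(3) by (elim disjE) linarith+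
    from q consider "i = 3 * q" | "i = Suc (3 * q)" | "Suc i = 3 * (q + 1)" by (elim disjE) auto
    then have "dominates f ?D ((f ^^ i) c)"
    proof cases
      case 1
      then show ?thesis using dominates_funpow(1)[OF refl I[OF j], of f c] by metis
    next
      case 2
      then show ?thesis using dominates_funpow(3)[OF refl I[OF j], of f c] by metis
    next
      case 3
      show ?thesis
      proof (cases "q + 1 < n")
        case True
        then have "Suc i \<in> ?I" unfolding 3 by (rule I)
        then show ?thesis by (rule dominates_funpow(2)[OF refl])
      next
        case False
        then have "Suc i = k" using i j assms(3) 3 by simp
        then have "f ((f ^^ i) c) = c" using period[OF assms(2)] by auto
        moreover have "c \<in> ?D" using imageI[OF I[of 0], of "\<lambda>i. (f ^^ i) c"] j by simp
        ultimately show ?thesis unfolding dominates_def by simp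
      qed
    qed
    then show "dominates f ?D ((f ^^ i) c) \<or>
      dominates f ?D ((f ^^ Suc i) c) \<and> card (tree ((f ^^ i) c)) = 1" ..
  next
    have "card ?I \<le> n" using card_image_le[of "{..<n}" "\<lambda>i. 3 * i"] by simp
    then show "3 * card ?I < card V" using assms(4) by linarith
  qed simp
qed

text \<open>A third of \<open>k\<close>, rounded up, is good enough if 3 divides \<open>k\<close>.
  With remainder 1 either a cycle vertex with trivial tree can stay undominated, or all trees have
  two vertices and there is ample room. With remainder 2 only a single pendant vertex is critical:
  it is extremal for \<open>k = 5\<close>, and otherwise two gaps of four absorb the
  remainder.\<close>

lemma no_deep:
  assumes "deep = {}" "V \<noteq> C"
  shows "(\<exists>D. isolates f V {} D \<and> 3 * card D < card V) \<or> (\<exists>R. blocks V R)"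
proof -
  have VC: "C \<subset> V" using assms C_subset by auto
  have pend: "f v \<in> C" if "v \<in> V" for v
    using that depth[OF that] assms(1) f_in_C by (auto simp: deep_def)
  obtain c0 where c0: "c0 \<in> C" using C_nonempty by auto
  define m where "m = k div 3"
  consider "k = 3 * m" | "k = 3 * m + 1" | "k = 3 * m + 2"
    unfolding m_def by linarith
  then show ?thesis
  proof cases
    case 1
    then show ?thesis using every_third[OF assms(1) c0, of m] card_V_ge[OF VC] by simp
  next
    case 2
    show ?thesis
    proof (cases "\<exists>c\<in>C. card (tree c) = 1")
      case True
      then obtain c where c: "c \<in> C" "card (tree c) = 1" by blast
      \<comment> \<open>The positions 2, 5, ..., 3m - 1 dominate 1, ..., 3m and leave out only
        position 0, which is \<open>c\<close> with its trivial tree.\<close>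
      let ?I = "(\<lambda>i. 3 * i + 2) ` {..<m}"
      let ?D = "(\<lambda>i. (f ^^ i) c) ` ?I"
      have I: "3 * j + 2 \<in> ?I" if "j < m" for j using that by simp
      have dom: "dominates f ?D ((f ^^ Suc i) c)" if "i < 3 * m" for i
      proof -
        obtain q where q: "i = 3 * q \<or> i = 3 * q + 1 \<or> i = 3 * q + 2"
          using third_cases by blast
        have j: "q < m" using q \<open>i < 3 * m\<close> by (elim disjE) linarith+
        from q consider "Suc (Suc i) = 3 * q + 2" | "Suc i = 3 * q + 2" | "i = 3 * q + 2"
          by (elim disjE) auto
        then show ?thesis
        proof cases
          case 1
          then show ?thesis using dominates_funpow(2)[OF refl, of "Suc i" ?I f c] I[OF j] by metis
        next
          case 2
          then show ?thesis using dominates_funpow(1)[OF refl, of "Suc i" ?I f c] I[OF j] by metis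
        next
          case 3
          then show ?thesis using dominates_funpow(3)[OF refl, of i ?I f c] I[OF j] by metis
        qed
      qed
      have "\<exists>D. isolates f V {} D \<and> 3 * card D < card V"
      proof (rule orbit_selection[OF c(1) _ assms(1), where I = ?I])
        fix i assume i: "i < k"
        show "dominates f ?D ((f ^^ i) c) \<or> dominates f ?D ((f ^^ Suc i) c) \<and> card (tree ((f ^^ i) c)) = 1"
        proof (cases i)
          case 0
          then show ?thesis using c dom[of 0] 2 k_ge_3 by simp
        next
          case (Suc j)
          then have "j < 3 * m" using i 2 by simp
          then show ?thesis using dom[of j] Suc by blast
        qed
      next
        have "card ?I \<le> m" using card_image_le[of "{..<m}" "\<lambda>i. 3 * i + 2"] by simp
        then show "3 * card ?I < card V" using card_V_ge[OF VC] 2 by linarith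
      qed simp
      then show ?thesis ..
    next
      case False
      have "2 \<le> card (tree c)" if "c \<in> C" for c using False tree_ge_1[OF that] that by fastforce
      then have "(\<Sum>c\<in>C. 2) \<le> (\<Sum>c\<in>C. card (tree c))" by (rule sum_mono)
      then have V: "2 * k \<le> card V" using card_V card_C by simp
      then show ?thesis using every_third[OF assms(1) c0, of "Suc m"] 2 k_ge_3 by simp
    qed
  next
    case 3
    show ?thesis
    proof (cases "card V = Suc k")
      case False
      then show ?thesis
        using every_third[OF assms(1) c0, of "Suc m"] 3 card_V_ge[OF VC] by simp
    next
      case True
      obtain x where x: "x \<in> V" "x \<notin> C" using VC by blast
      then have "card (insert x C) = card V" using True finite_C card_C by simp
      then have V: "V = insert x C" using x C_subset finite_V by (metis card_subset_eq insert_subset)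
      have fx: "f x \<in> C" using pend x by blast
      show ?thesis
      proof (cases "m = 1")
        case True
        then show ?thesis using blocks.lollipop[of x] x fx 3 V by auto
      next
        case False
        then have m: "2 \<le> m" using 3 k_ge_3 by linarith
        have tree: "card (tree ((f ^^ i) (f x))) = 1" if "i < k" "i \<noteq> 0" for i
        proof -
          have *: "(f ^^ i) (f x) \<in> C" "(f ^^ i) (f x) \<noteq> f x"
            using funpow_in_C[OF fx] funpow_eq_iff[OF fx, of i 0] that by auto
          then have "tree ((f ^^ i) (f x)) = {(f ^^ i) (f x)}"
            unfolding tree_def using V x fx by auto
          then show ?thesis by simp
        qed
        \<comment> \<open>Starting at the neighbour \<open>f x\<close> of the pendant vertex, the
          gaps are 4, 4, 3, ..., 3. These \<open>m\<close> gaps add up to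
          \<open>3 * m + 2 = k\<close>, and only positions 2 and 6, whose trees are trivial, may
          stay undominated.\<close>
        let ?I = "{0, 4} \<union> (\<lambda>i. 3 * i + 2) ` {2..<m}"
        let ?D = "(\<lambda>i. (f ^^ i) (f x)) ` ?I"
        have I: "3 * j + 2 \<in> ?I" if "2 \<le> j" "j < m" for j using that by simp
        have zero: "f x \<in> ?D" by (intro image_eqI[of _ _ 0]) auto
        have last: "dominates f ?D ((f ^^ i) (f x))" if "Suc i = k" for i
        proof -
          have "f ((f ^^ i) (f x)) = f x" using period[OF fx] that by auto
          then show ?thesis using zero unfolding dominates_def by simp
        qed
        have dom: "dominates f ?D ((f ^^ i) (f x))" if i: "i < k" "i \<noteq> 2" "i \<noteq> 6" for i
        proof -
          have "i = 0 \<or> i = 1 \<or> i = 3 \<or> i = 4 \<or> i = 5 \<or> 7 \<le> i" using i(2,3) by presburger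
          then consider "i = 0" | "i = 1" | "i = 3" | "i = 4" | "i = 5" | "7 \<le> i" by blast
          then show ?thesis
          proof cases
            case 1 then show ?thesis using dominates_funpow(1)[OF refl, of 0 ?I f "f x"] by simp
          next
            case 2 then show ?thesis using dominates_funpow(3)[OF refl, of 0 ?I f "f x"] by simp
          next
            case 3 then show ?thesis using dominates_funpow(2)[OF refl, of 3 ?I f "f x"] by simp
          next
            case 4 then show ?thesis using dominates_funpow(1)[OF refl, of 4 ?I f "f x"] by simp
          next
            case 5 then show ?thesis using dominates_funpow(3)[OF refl, of 4 ?I f "f x"] by simp
          next
            case 6
            \<comment> \<open>The shift by one makes the position \<open>3 * q + 2\<close> equal to
              \<open>i\<close> or next to it. The value \<open>q = m\<close> occurs only at the last
              position, which is next to \<open>f x\<close>.\<close>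
            obtain q where q: "i - 1 = 3 * q \<or> i - 1 = 3 * q + 1 \<or> i - 1 = 3 * q + 2"
              using third_cases by blast
            have j: "2 \<le> q" using q 6 by (elim disjE) linarith+
            have "Suc i = 3 * q + 2 \<or> i = 3 * q + 2 \<or> i = Suc (3 * q + 2)"
              using q 6 by (elim disjE) auto
            moreover have "q < m \<or> Suc i = k" using q 6 i(1) 3 by (elim disjE) auto
            ultimately consider "Suc i = k" | "Suc i = 3 * q + 2" "q < m"
              | "i = 3 * q + 2" "q < m" | "i = Suc (3 * q + 2)" "q < m"
              by blast
            then show ?thesis
            proof cases
              case 1 then show ?thesis by (rule last)
            next
              case 2
              then show ?thesis using dominates_funpow(2)[OF refl, of i ?I f "f x"] I[OF j] by metis
            next
              case 3
              then show ?thesis using dominates_funpow(1)[OF refl, of i ?I f "f x"] I[OF j] by metis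
            next
              case 4
              then show ?thesis using dominates_funpow(3)[OF refl I[OF j], of f "f x"] by metis
            qed
          qed
        qed
        have "\<exists>D. isolates f V {} D \<and> 3 * card D < card V"
        proof (rule orbit_selection[OF fx _ assms(1), where I = ?I])
          fix i assume i: "i < k"
          show "dominates f ?D ((f ^^ i) (f x)) \<or>
            dominates f ?D ((f ^^ Suc i) (f x)) \<and> card (tree ((f ^^ i) (f x))) = 1"
          proof (cases "i = 2 \<or> i = 6")
            case True
            moreover from this have "Suc i \<noteq> k" "i \<noteq> 0" using 3 by (auto, presburger)
            ultimately have "dominates f ?D ((f ^^ Suc i) (f x))" using dom[of "Suc i"] i by force
            then show ?thesis using tree[OF i] \<open>i \<noteq> 0\<close> by blast
          next
            case False
            then show ?thesis using dom[OF i] by blast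
          qed
        next
          have "card ?I \<le> card {0, 4::nat} + card ((\<lambda>i. 3 * i + 2) ` {2..<m})" by (rule card_Un_le)
          also have "\<dots> \<le> 2 + (m - 2)"
            using card_image_le[of "{2..<m}" "\<lambda>i. 3 * i + 2"] by simp
          finally show "3 * card ?I < card V" using True 3 m by linarith
        qed simp
        then show ?thesis ..
      qed
    qed
  qed
qed

lemma shallow:
  "V = C \<and> k \<in> {5, 6, 9} \<or> (\<exists>D. isolates f V {} D \<and> 3 * card D < card V) \<or> (\<exists>R. blocks V R)"
  using pure_cycle no_deep some_deep all_deep by metis

end

section \<open>The induction\<close>

context cyclic_map
begin

text \<open>Length 5 stays in the conclusion although C_5 is not extremal: its isolation number 2 is
  too large for the second alternative, and C_5 can occur as the rest in the induction.\<close>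

theorem isolates_or_blocks:
  assumes "admissible V"
  shows "V = C \<and> k \<in> {5, 6, 9} \<or> (\<exists>D. isolates f V {} D \<and> 3 * card D < card V) \<or>
    (\<exists>R. blocks V R)"
  using assms
proof (induction "card V" arbitrary: V rule: less_induct)
  case less
  note adm = less.prems[unfolded admissible_def]
  show ?case
  proof (cases "\<forall>v\<in>V. v \<in> C \<or> f v \<in> C \<or> f (f v) \<in> C")
    case True
    interpret shallow_cyclic_map f C k V using less.prems True by unfold_locales auto
    show ?thesis by (rule shallow)
  next
    case False
    define height where "height v = (LEAST m. (f ^^ m) v \<in> C)" for v
    have height: "height v = Suc (height (f v))" if v: "v \<in> V" "v \<notin> C" for v
    proof -
      obtain m where m: "(f ^^ m) v \<in> C" using adm v by blast
      have "height v = Suc (LEAST m. (f ^^ Suc m) v \<in> C)" unfolding height_def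

        by (rule Least_Suc[where P = "\<lambda>m. (f ^^ m) v \<in> C", OF m]) (use v in simp)
      then show ?thesis by (simp add: height_def funpow_swap1)
    qed
    from False obtain v0 where v0: "v0 \<in> V" "v0 \<notin> C" "f v0 \<notin> C" "f (f v0) \<notin> C" by blast
    have f_V: "f v \<in> V" if "v \<in> V" for v using that adm by blast
    then have "f v0 \<in> V" "f (f v0) \<in> V" using v0 by auto
    then have "3 \<le> height v0"
      using height[of v0] height[of "f v0"] height[of "f (f v0)"] v0 by simp
    have fin: "finite (height ` V)" using adm by simp
    obtain z where z: "z \<in> V" "\<And>v. v \<in> V \<Longrightarrow> height v \<le> height z"
      using Max_in[OF fin] Max_ge[OF fin] v0(1) by (metis emptyE imageE imageI)
    have zero: "height v = 0" if "v \<in> C" for v using that by (simp add: height_def)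
    have Suc: "height v \<le> Suc (height (f v))" if "v \<in> V" for v
      using height[OF that] zero[of v] by (cases "v \<in> C") auto
    define y where "y = f z"
    define x where "x = f y"
    have in_V: "y \<in> V" "x \<in> V" "f x \<in> V" using f_V z by (auto simp: y_def x_def)
    have "3 \<le> height z" using z(2)[OF v0(1)] \<open>3 \<le> height v0\<close> by simp
    then have hx: "height z \<le> height x + 2" "1 \<le> height x"
      using Suc[OF z(1)] Suc[OF in_V(1)] by (auto simp: y_def x_def)
    have xC: "x \<notin> C" using hx zero by fastforce
    then have yC: "y \<notin> C" and zC: "z \<notin> C" using f_in_C x_def y_def by blast+
    have hz: "height z = height x + 2"
      using height[OF z(1) zC] height[OF in_V(1) yC] by (simp add: x_def y_def)
    define S where "S = {v \<in> V. v = x \<or> f v = x \<or> f (f v) = x}"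
    have "S \<subseteq> V" by (auto simp: S_def)
    have S3: "{x, y, z} \<subseteq> S" using z in_V by (auto simp: S_def x_def y_def)
    have SC: "S \<inter> C = {}" using xC f_in_C by (auto simp: S_def)
    \<comment> \<open>By the choice of \<open>z\<close>: a vertex outside \<open>S\<close> mapped
      into \<open>S\<close> would have height \<open>height x + 3\<close>, one more than
      \<open>height z\<close>. Hence the rest is closed under \<open>f\<close>.\<close>
    have up: "f v \<notin> S" if "v \<in> V - S" for v
    proof
      assume "f v \<in> S"
      then have "f (f (f v)) = x" using that by (auto simp: S_def)
      moreover have "f v \<notin> C" using \<open>f v \<in> S\<close> SC by auto
      moreover have "f (f v) \<notin> C" using calculation xC f_in_C by metis
      moreover have "f v \<in> V" "f (f v) \<in> V" "v \<in> V" "v \<notin> C" using f_V that f_in_C \<open>f v \<notin> C\<close> by auto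
      ultimately have "height v = height x + 3"
        using height[of v] height[of "f v"] height[of "f (f v)"] by simp
      then show False using z(2)[of v] that hz by simp
    qed
    \<comment> \<open>Otherwise \<open>x\<close> would be periodic, although the height drops at
      every step off the cycle.\<close>
    have fxS: "f x \<notin> S"
    proof
      assume "f x \<in> S"
      then consider "f x = x" | "f (f x) = x" | "f (f (f x)) = x" by (auto simp: S_def)
      then show False
      proof cases
        case 1
        then show False using height[OF in_V(2) xC] by simp
      next
        case 2
        then have "f x \<notin> C" using f_in_C[of "f x"] xC by auto
        then show False using height[OF in_V(2) xC] height[OF in_V(3)] 2 by simp
      next
        case 3
        then have "f (f x) \<notin> C" using f_in_C[of "f (f x)"] xC by auto
        moreover from this have "f x \<notin> C" using f_in_C by blast
        moreover have "f (f x) \<in> V" using f_V in_V by auto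
        ultimately show False
          using height[OF in_V(2) xC] height[OF in_V(3)] height[of "f (f x)"] 3 by simp
      qed
    qed
    have distinct: "card {x, y, z} = 3"
    proof -
      have "height z = height y + 1" "height y = height x + 1"
        using height[OF z(1) zC] height[OF in_V(1) yC] by (simp_all flip: x_def y_def)
      then have "x \<noteq> y" "y \<noteq> z" "x \<noteq> z" by auto
      then show ?thesis by simp
    qed
    define W where "W = V - S"
    have W: "admissible W"
      unfolding admissible_def using adm SC up by (auto simp: W_def)
    have finS: "finite S" and finV: "finite V" using adm by (auto simp: S_def)
    have card_V: "card V = card W + card S"
      using \<open>S \<subseteq> V\<close> card_Diff_subset[OF finS] card_mono[OF finV] by (simp add: W_def)
    have card_S: "3 \<le> card S" using distinct card_mono[OF finS S3] by simp
    have fx: "f x \<in> W" using fxS in_V by (simp add: W_def)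
    \<comment> \<open>\<open>x\<close> dominates an end of each edge between a vertex of
      \<open>S\<close> and its image, and also \<open>f x\<close>, which is why \<open>f x\<close>
      may count as dominated in \<open>W\<close>.\<close>
    have extend: "isolates f V {} (insert x D)" if "isolates f W {f x} D" for D
    proof -
      have "insert x D \<subseteq> V" using that in_V by (auto simp: isolates_def W_def)
      moreover have "dominates f (insert x D) v \<or> dominates f (insert x D) (f v)" if v: "v \<in> V" for v
      proof (cases "v \<in> S")
        case True
        then show ?thesis by (auto simp: S_def dominates_def)
      next
        case False
        then have "v = f x \<or> f v = f x \<or> dominates f D v \<or> dominates f D (f v)"
          using \<open>isolates f W {f x} D\<close> v by (auto simp: isolates_def W_def)
        then show ?thesis
          using dominates_mono[of f D _ "insert x D"] by (auto simp: dominates_def)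
      qed
      ultimately show ?thesis by (auto simp: isolates_def)
    qed
    have weaken: "isolates f W {f x} D" if "isolates f W {} D" for D
      using that by (auto simp: isolates_def)
    have result: "\<exists>D. isolates f V {} D \<and> 3 * card D < card V"
      if "isolates f W {f x} D" "3 * Suc (card D) < card V" for D
    proof (intro exI conjI)
      show "isolates f V {} (insert x D)" using extend that(1) .
      have "card (insert x D) \<le> Suc (card D)" by (rule card_insert_le_m1) auto
      then show "3 * card (insert x D) < card V" using that(2) by simp
    qed
    have exact: "\<exists>D. isolates f W {f x} D \<and> 3 * card D \<le> card W" if "blocks W R" for R
      using blocks_isolating_roots[OF that] weaken by blast
    have "card W < card V" using card_V card_S by simp
    from less.hyps[OF this W] consider "W = C" "k = 5" | "W = C" "k = 6 \<or> k = 9"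
      | D where "isolates f W {} D" "3 * card D < card W" | R where "blocks W R" by blast
    then show ?thesis
    proof cases
      case 1
      \<comment> \<open>On C_5 with \<open>f x\<close> dominated one vertex suffices, so two are
        used for at least eight vertices.\<close>
      have "isolates f W {f x} {f (f (f x))}"
        using five_cycle[of "f x"] fx 1 by (auto simp: isolates_def dominates_def)
      then show ?thesis using result[of "{f (f (f x))}"] card_V card_S 1 card_C by simp
    next
      case 2
      obtain D where "isolates f W {f x} D" "3 * card D + 3 \<le> card W"
        using cycle_saving[OF 2(2)] fx 2(1) by blast
      then show ?thesis using result[of D] card_V card_S by simp
    next
      case 3
      then show ?thesis using result[OF weaken[OF 3(1)]] card_V card_S by simp
    next
      case 4
      show ?thesis
      proof (cases "card S = 3")
        \<comment> \<open>At least four vertices were removed at the cost of one, which already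
          makes the inequality strict.\<close>
        case False
        then show ?thesis using exact[OF 4] result card_V card_S by fastforce
      next
        case True
        then have "S = {x, y, z}" using S3 distinct finS by (metis card_subset_eq)
        then have V: "V = W \<union> {x, y, z}" "x \<notin> W" "y \<notin> W" "z \<notin> W"
          using \<open>S \<subseteq> V\<close> by (auto simp: W_def)
        have hang: "\<exists>R. blocks V R" if "blocks W R" "f x \<in> R" for R
          using blocks.hang[OF that _ _ V(2-4)] V(1) x_def y_def by metis
        show ?thesis
        proof (cases "f x \<in> R")
          case True
          then show ?thesis using hang 4 by blast
        next
          case notin: False
          show ?thesis
          proof (cases "card W = 3")
            case True
            \<comment> \<open>Nothing can be saved in a triangle, but any of its vertices can be the
              circled one, so \<open>f x\<close> is made the root.\<close>
            have "C \<subseteq> W" using blocks_basic[OF 4] by blast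
            moreover have "finite W" using finV by (simp add: W_def)
            ultimately have "C = W" using True card_C k_ge_3 by (intro card_seteq) auto
            then have "W = C" "k = 3" using True card_C by auto
            then show ?thesis using hang[of "{f x}"] blocks.triangle[of "f x"] fx by auto
          next
            case False
            then obtain D where "isolates f W {f x} D" "3 * card D + 3 \<le> card W"
              using blocks_saving[OF 4 fx notin] by blast
            then show ?thesis using result[of D] card_V card_S by simp
          qed
        qed
      qed
    qed
  qed
qed

end

section \<open>Isomorphisms, isolation numbers and cycles of graphs\<close>

definition iso_by :: "('a \<Rightarrow> 'b) \<Rightarrow> 'a pair_pre_digraph \<Rightarrow> 'b pair_pre_digraph \<Rightarrow> bool" where
  "iso_by h G H \<longleftrightarrow> pair_wf_digraph G \<and> inj_on h (pverts G) \<and>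
     pverts H = h ` pverts G \<and> parcs H = map_prod h h ` parcs G"

lemma arc_in_verts:
  "pair_wf_digraph G \<Longrightarrow> (u, v) \<in> parcs G \<Longrightarrow> u \<in> pverts G \<and> v \<in> pverts G"
  by (auto dest: pair_wf_digraph.in_arcsD1 pair_wf_digraph.in_arcsD2)

text \<open>For graphs whose arcs are pairs, the other components of an isomorphism are determined
  by its vertex map and the two projections.\<close>

lemma digraph_iso_iff: "digraph_iso (with_proj G) (with_proj H) \<longleftrightarrow> (\<exists>h. iso_by h G H)"
proof
  assume "digraph_iso (with_proj G) (with_proj H)"
  then obtain hom where hom: "pre_digraph.digraph_isomorphism (with_proj G) hom"
    and H: "with_proj H = app_iso hom (with_proj G)"
    by (auto simp: digraph_iso_def)
  have ends: "iso_tail hom = fst" "iso_head hom = snd"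
    using arg_cong[OF H, of tail] arg_cong[OF H, of head] by simp_all
  have "iso_arcs hom e = map_prod (iso_verts hom) (iso_verts hom) e" if "e \<in> parcs G" for e
    using hom that ends by (auto simp: pre_digraph.digraph_isomorphism_def prod_eq_iff)
  then have "parcs H = map_prod (iso_verts hom) (iso_verts hom) ` parcs G"
    using arg_cong[OF H, of arcs] by simp
  moreover have "pverts H = iso_verts hom ` pverts G"
    using arg_cong[OF H, of verts] by simp
  moreover have "pair_wf_digraph G" "inj_on (iso_verts hom) (pverts G)"
    using hom by (simp_all add: pre_digraph.digraph_isomorphism_def wf_digraph_wp_iff)
  ultimately show "\<exists>h. iso_by h G H" by (auto simp: iso_by_def)
next
  assume "\<exists>h. iso_by h G H"
  then obtain h where h: "iso_by h G H" ..
  let ?hom = "\<lparr>iso_verts = h, iso_arcs = map_prod h h, iso_head = snd, iso_tail = fst\<rparr>"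
  have wf: "pair_wf_digraph G" and inj: "inj_on h (pverts G)" using h by (auto simp: iso_by_def)
  have "inj_on (map_prod h h) (parcs G)"
  proof (rule inj_on_subset)
    show "inj_on (map_prod h h) (pverts G \<times> pverts G)" using inj by (rule map_prod_inj_on) (rule inj)
  qed (use arc_in_verts[OF wf] in auto)
  then have "pre_digraph.digraph_isomorphism (with_proj G) ?hom"
    using wf inj by (auto simp: pre_digraph.digraph_isomorphism_def wf_digraph_wp_iff)
  moreover have "with_proj H = app_iso ?hom (with_proj G)"
    using h by (simp add: iso_by_def app_iso_def with_proj_def)
  ultimately show "digraph_iso (with_proj G) (with_proj H)"
    unfolding digraph_iso_def by blast
qed

lemma iso_by_sym:
  assumes "iso_by h G H"
  shows "iso_by (the_inv_into (pverts G) h) H G"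
proof -
  have wf: "pair_wf_digraph G" and inj: "inj_on h (pverts G)"
    and V: "pverts H = h ` pverts G" and E: "parcs H = map_prod h h ` parcs G"
    using assms by (auto simp: iso_by_def)
  let ?g = "the_inv_into (pverts G) h"
  have g: "?g (h v) = v" if "v \<in> pverts G" for v using the_inv_into_f_f[OF inj that] .
  have "pair_wf_digraph H"
    using arc_in_verts[OF wf] by (unfold_locales) (auto simp: V E)
  moreover have "inj_on ?g (pverts H)" unfolding V using inj by (rule inj_on_the_inv_into)
  moreover have "pverts G = ?g ` pverts H" unfolding V using g by force
  moreover have "map_prod ?g ?g (map_prod h h e) = e" if "e \<in> parcs G" for e
    using arc_in_verts[OF wf, of "fst e" "snd e"] that g by (cases e) auto
  then have "parcs G = map_prod ?g ?g ` parcs H" unfolding E by force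
  ultimately show ?thesis by (simp add: iso_by_def)
qed

section \<open>Isolation numbers under isomorphism\<close>

lemma isolating_iff:
  assumes "pair_wf_digraph G"
  shows "isolating G D \<longleftrightarrow> D \<subseteq> pverts G \<and>
    (\<forall>(u, v)\<in>parcs G. u \<in> closed_nbhd G D \<or> v \<in> closed_nbhd G D)"
  using arc_in_verts[OF assms] unfolding isolating_def independent_set_def by fast

lemma isolating_image:
  assumes "iso_by h G H" "isolating G D"
  shows "isolating H (h ` D)" "card (h ` D) = card D"
proof -
  have wf: "pair_wf_digraph G" and inj: "inj_on h (pverts G)"
    and V: "pverts H = h ` pverts G" and E: "parcs H = map_prod h h ` parcs G"
    using assms by (auto simp: iso_by_def)
  have wfH: "pair_wf_digraph H" using iso_by_sym[OF assms(1)] by (simp add: iso_by_def)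
  have D: "D \<subseteq> pverts G" using assms(2) by (simp add: isolating_def)
  have N: "h v \<in> closed_nbhd H (h ` D)" if "v \<in> closed_nbhd G D" for v
    using that unfolding closed_nbhd_def V E by force
  then show "isolating H (h ` D)"
    using assms(2) D unfolding isolating_iff[OF wf] isolating_iff[OF wfH] by (fastforce simp: V E)
  show "card (h ` D) = card D" using inj D by (meson card_image inj_on_subset)
qed

lemma isolation_number_iso:
  assumes "iso_by h G H"
  shows "isolation_number G = isolation_number H"
proof -
  have "card ` {D. isolating G D} \<subseteq> card ` {D. isolating H D}"
    using isolating_image[OF assms] by (metis (mono_tags, lifting) image_eqI image_subsetI mem_Collect_eq)
  moreover have "card ` {D. isolating H D} \<subseteq> card ` {D. isolating G D}"
    using isolating_image[OF iso_by_sym[OF assms]]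
    by (metis (mono_tags, lifting) image_eqI image_subsetI mem_Collect_eq)
  ultimately show ?thesis unfolding isolation_number_def by (metis subset_antisym)
qed

lemma finite_isolating: "finite (pverts G) \<Longrightarrow> finite {D. isolating G D}"
  by (rule finite_subset[of _ "Pow (pverts G)"]) (auto simp: isolating_def)

lemma isolation_number_le:
  "finite (pverts G) \<Longrightarrow> isolating G D \<Longrightarrow> isolation_number G \<le> card D"
  unfolding isolation_number_def by (intro Min_le) (auto simp: finite_isolating)

lemma isolation_number_attained:
  assumes "finite (pverts G)"
  obtains D where "isolating G D" "card D = isolation_number G"
proof -
  have "isolating G (pverts G)"
    by (auto simp: isolating_def independent_set_def closed_nbhd_def)
  then have "isolation_number G \<in> card ` {D. isolating G D}"
    unfolding isolation_number_def by (intro Min_in) (auto simp: finite_isolating[OF assms])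
  then show thesis using that by auto
qed

section \<open>Connectivity and cycles of graphs\<close>

lemma connected_iff:
  assumes "pair_wf_digraph G" "sym (parcs G)"
  shows "connected (with_proj G) \<longleftrightarrow>
    pverts G \<noteq> {} \<and> (\<forall>u\<in>pverts G. \<forall>v\<in>pverts G. (u, v) \<in> (parcs G)\<^sup>*)"
proof -
  have arcs: "parcs (mk_symmetric (with_proj G)) = parcs G"
    using assms(2) by (force simp: mk_symmetric_def sym_def)
  have verts: "pverts (mk_symmetric (with_proj G)) = pverts G" by (simp add: mk_symmetric_def)
  have "(u, v) \<in> rtrancl_on (pverts G) (parcs G) \<longleftrightarrow> (u, v) \<in> (parcs G)\<^sup>*"
    if "u \<in> pverts G" "v \<in> pverts G" for u v
    using rtrancl_consistent_rtrancl_on[OF _ that] arc_in_verts[OF assms(1)] rtrancl_on_rtranclI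
    by metis
  then show ?thesis
    unfolding connected_def strongly_connected_def reachable_def by (simp add: arcs verts)
qed

lemma pair_graph_sym: "pair_graph G \<Longrightarrow> sym (parcs G)"
  using pair_sym_digraph.arcs_symmetric[of G] pair_graph_def pair_pseudo_graph_def
  by (metis symI)

lemma pair_graph_wf: "pair_graph G \<Longrightarrow> pair_wf_digraph G"
  by (simp add: pair_graph_def pair_digraph_def pair_fin_digraph_def)

lemma pair_graph_finite: "pair_graph G \<Longrightarrow> finite (pverts G)"
  by (simp add: pair_graph_def pair_digraph_def pair_fin_digraph_def pair_fin_digraph_axioms_def)

lemma pair_graph_loopfree: "pair_graph G \<Longrightarrow> (u, v) \<in> parcs G \<Longrightarrow> u \<noteq> v"
  using pair_loopfree_digraph.no_loops'[of G u v] by (auto simp: pair_graph_def pair_digraph_def)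

lemma wf_cycle_graph: "0 < k \<Longrightarrow> pair_wf_digraph (cycle_graph k)"
  by unfold_locales (auto simp: cycle_graph_def edge_graph_def)

lemma iso_by_cycle_graph:
  assumes "0 < k" "inj_on p {..<k}"
  shows "iso_by p (cycle_graph k) (edge_graph (p ` {..<k}) {(p i, p (Suc i mod k)) |i. i < k})"
  using assms wf_cycle_graph[OF assms(1)]
  by (auto simp: iso_by_def cycle_graph_def edge_graph_def image_iff)

lemma is_cycle_of_iff:
  assumes "pair_graph G"
  shows "is_cycle_of C G \<longleftrightarrow> (\<exists>k p. 3 \<le> k \<and> inj_on p {..<k} \<and>
    C = edge_graph (p ` {..<k}) {(p i, p (Suc i mod k)) |i. i < k} \<and>
    p ` {..<k} \<subseteq> pverts G \<and> (\<forall>i<k. (p i, p (Suc i mod k)) \<in> parcs G))"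
    (is "_ \<longleftrightarrow> ?R")
proof
  assume C: "is_cycle_of C G"
  then obtain k h where k: "3 \<le> k" and h: "iso_by h C (cycle_graph k)"
    and sub: "pverts C \<subseteq> pverts G" "parcs C \<subseteq> parcs G"
    by (auto simp: is_cycle_of_def digraph_iso_iff subgraph_def)
  obtain p where p: "iso_by p (cycle_graph k) C" using iso_by_sym[OF h] by blast
  then have inj: "inj_on p {..<k}"
    by (simp add: iso_by_def cycle_graph_def edge_graph_def)
  have "C = edge_graph (p ` {..<k}) {(p i, p (Suc i mod k)) |i. i < k}"
    using p iso_by_cycle_graph[OF _ inj] k by (auto simp: iso_by_def intro: pair_pre_digraph.equality)
  moreover from this have "p ` {..<k} \<subseteq> pverts G" "\<forall>i<k. (p i, p (Suc i mod k)) \<in> parcs G"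
    using sub by (auto simp: edge_graph_def)
  ultimately show ?R using k inj by blast
next
  assume ?R
  then obtain k p where k: "3 \<le> k" and inj: "inj_on p {..<k}"
    and C: "C = edge_graph (p ` {..<k}) {(p i, p (Suc i mod k)) |i. i < k}"
    and sub: "p ` {..<k} \<subseteq> pverts G" "\<forall>i<k. (p i, p (Suc i mod k)) \<in> parcs G"
    by blast
  have iso: "iso_by (the_inv_into (pverts (cycle_graph k)) p) C (cycle_graph k)"
    using iso_by_sym[OF iso_by_cycle_graph[OF _ inj]] k C by simp
  then have "pair_wf_digraph C" by (simp add: iso_by_def)
  moreover have "parcs C \<subseteq> parcs G"
    using sub(2) pair_graph_sym[OF assms] by (auto simp: C edge_graph_def dest: symD)
  ultimately have "subgraph (with_proj C) (with_proj G)"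
    using sub(1) pair_graph_wf[OF assms]
    by (auto simp: subgraph_def wf_digraph_wp_iff C edge_graph_def)
  then show "is_cycle_of C G"
    using iso k by (auto simp: is_cycle_of_def digraph_iso_iff)
qed

section \<open>A map for every unicyclic graph\<close>

lemma shortest_path:
  assumes "(u, v) \<in> R\<^sup>*"
  obtains n p where "p 0 = u" "p n = v" "\<And>i. i < n \<Longrightarrow> (p i, p (Suc i)) \<in> R" "inj_on p {..n}"
proof -
  define n where "n = (LEAST n. (u, v) \<in> R ^^ n)"
  obtain m where "(u, v) \<in> R ^^ m" using assms rtrancl_power by blast
  then have "(u, v) \<in> R ^^ n" unfolding n_def by (rule LeastI)
  then obtain p where p: "p 0 = u" "p n = v" "\<And>i. i < n \<Longrightarrow> (p i, p (Suc i)) \<in> R"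
    by (auto simp: relpow_fun_conv)
  have neq: "p i \<noteq> p j" if ij: "i < j" "j \<le> n" for i j
  proof
    assume eq: "p i = p j"
    \<comment> \<open>\<open>q\<close> is the walk with the part from \<open>i\<close> to
      \<open>j\<close> cut out; it would be shorter than the minimum \<open>n\<close>.\<close>
    define q where "q l = (if l \<le> i then p l else p (l + (j - i)))" for l
    have "(q l, q (Suc l)) \<in> R" if "l < n - (j - i)" for l
    proof -
      consider "l < i" | "l = i" | "i < l" by linarith
      then show ?thesis
      proof cases
        case 2
        then have "q l = p j" "q (Suc l) = p (Suc j)" using eq ij by (auto simp: q_def)
        then show ?thesis using p(3)[of j] that ij 2 by simp
      next
        case 3
        then show ?thesis using p(3)[of "l + (j - i)"] that ij by (simp add: q_def)
      qed (use p(3)[of l] ij in \<open>simp add: q_def\<close>)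
    qed
    moreover have "q 0 = u" using p by (simp add: q_def)
    moreover have "q (n - (j - i)) = v" using p ij eq by (cases "j = n") (auto simp: q_def)
    ultimately have "(u, v) \<in> R ^^ (n - (j - i))" unfolding relpow_fun_conv by blast
    then have "n \<le> n - (j - i)" unfolding n_def by (rule Least_le)
    then show False using ij by simp
  qed
  have "inj_on p {..n}"
    by (rule inj_onI) (metis neq atMost_iff linorder_neqE_nat)
  with p show thesis by (rule that)
qed

lemma cyclic_map_cycle:
  assumes k: "3 \<le> k" and inj: "inj_on p {..<k}" and f: "\<And>i. i < k \<Longrightarrow> f (p i) = p (Suc i mod k)"
  shows "cyclic_map f (p ` {..<k}) k"
proof
  have pow: "(f ^^ i) (p j) = p ((i + j) mod k)" if "j < k" for i j
    using that f k by (induction i) (simp_all add: mod_Suc_eq)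
  show "card (p ` {..<k}) = k" using inj by (simp add: card_image)
  fix c assume "c \<in> p ` {..<k}"
  then obtain j where j: "j < k" "c = p j" by auto
  show "(f ^^ k) c = c" using pow j by simp
  show "(\<lambda>i. (f ^^ i) c) ` {..<k} = p ` {..<k}"
  proof (intro equalityI subsetI)
    fix x assume "x \<in> p ` {..<k}"
    then obtain m where m: "m < k" "x = p m" by auto
    \<comment> \<open>Modulo \<open>k\<close>, \<open>m + k - j\<close> is the number of steps from
      \<open>p j\<close> to \<open>p m\<close>; adding \<open>k\<close> avoids truncated
      subtraction.\<close>
    have "((m + k - j) mod k + j) mod k = (m + k - j + j) mod k" by (simp add: mod_add_left_eq)
    also have "\<dots> = m" using m j by simp
    finally have "x = (f ^^ ((m + k - j) mod k)) c" using pow j m by simp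
    then show "x \<in> (\<lambda>i. (f ^^ i) c) ` {..<k}" using k by auto
  qed (use pow j k in auto)
qed (rule k)

text \<open>The edges used by \<open>f\<close> already connect the graph and contain its cycle. An
  edge outside them would close a path between its ends to a second cycle.\<close>

lemma unicyclic_cyclic_map:
  assumes G: "pair_graph G" and uni: "unicyclic G"
  obtains f C k where "cyclic_map f C k" "cyclic_map.admissible f C (pverts G)"
    "\<And>u v. (u, v) \<in> parcs G \<longleftrightarrow> u \<in> pverts G \<and> v \<in> pverts G \<and> (f u = v \<or> f v = u)"
proof -
  note sym = pair_graph_sym[OF G] and wf = pair_graph_wf[OF G]
  obtain C0 where C0: "is_cycle_of C0 G" and unique: "\<And>C'. is_cycle_of C' G \<Longrightarrow> C' = C0"
    using uni by (auto simp: unicyclic_def)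
  from C0 obtain k p where k: "3 \<le> k" and inj: "inj_on p {..<k}"
    and C0_eq: "C0 = edge_graph (p ` {..<k}) {(p i, p (Suc i mod k)) |i. i < k}"
    and sub: "p ` {..<k} \<subseteq> pverts G" "\<And>i. i < k \<Longrightarrow> (p i, p (Suc i mod k)) \<in> parcs G"
    unfolding is_cycle_of_iff[OF G] by auto
  define C where "C = p ` {..<k}"
  have conn: "(u, v) \<in> (parcs G)\<^sup>*" if "u \<in> pverts G" "v \<in> pverts G" for u v
    using uni that connected_iff[OF wf sym] by (auto simp: unicyclic_def)
  have p0: "p 0 \<in> C" using k by (auto simp: C_def)
  define dist where "dist v = (LEAST n. \<exists>c\<in>C. (v, c) \<in> parcs G ^^ n)" for v
  have closer: "\<exists>w. (v, w) \<in> parcs G \<and> dist w < dist v" if v: "v \<in> pverts G" "v \<notin> C" for v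
  proof -
    have "p 0 \<in> pverts G" using p0 sub(1) by (auto simp: C_def)
    then obtain n where "(v, p 0) \<in> parcs G ^^ n" using conn[OF v(1)] rtrancl_power by blast
    then have "\<exists>c\<in>C. (v, c) \<in> parcs G ^^ n" using p0 by blast
    then have "\<exists>c\<in>C. (v, c) \<in> parcs G ^^ dist v" unfolding dist_def by (rule LeastI)
    then obtain c where c: "c \<in> C" "(v, c) \<in> parcs G ^^ dist v" by blast
    show ?thesis
    proof (cases "dist v")
      case 0
      then show ?thesis using c v by simp
    next
      case (Suc m)
      then obtain w where w: "(v, w) \<in> parcs G" "(w, c) \<in> parcs G ^^ m"
        using c(2) relpow_Suc_D2 by metis
      then have "dist w \<le> m" unfolding dist_def using c(1) by (intro Least_le) blast
      then show ?thesis using w Suc by auto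
    qed
  qed
  define f where "f v = (if v \<in> C then p (Suc (the_inv_into {..<k} p v) mod k)
    else SOME w. (v, w) \<in> parcs G \<and> dist w < dist v)" for v
  have f_p: "f (p i) = p (Suc i mod k)" if "i < k" for i
    using that by (simp add: f_def C_def the_inv_into_f_f[OF inj])
  have f_off: "(v, f v) \<in> parcs G \<and> dist (f v) < dist v" if "v \<in> pverts G" "v \<notin> C" for v
    using someI_ex[OF closer[OF that]] that by (simp add: f_def)
  interpret cyclic_map f C k unfolding C_def using k inj f_p by (rule cyclic_map_cycle)
  have f_arc: "(v, f v) \<in> parcs G" if "v \<in> pverts G" for v
    using that f_off f_p sub(2) by (cases "v \<in> C") (auto simp: C_def)
  have f_V: "f v \<in> pverts G" if "v \<in> pverts G" for v
    using f_arc[OF that] arc_in_verts[OF wf] by blast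
  have reach: "\<exists>m. (f ^^ m) v \<in> C" if "v \<in> pverts G" for v
    using that
  proof (induction "dist v" arbitrary: v rule: less_induct)
    case less
    show ?case
    proof (cases "v \<in> C")
      case True
      then have "(f ^^ 0) v \<in> C" by simp
      then show ?thesis ..
    next
      case False
      then obtain m where "(f ^^ m) (f v) \<in> C" using less f_off f_V by blast
      then have "(f ^^ Suc m) v \<in> C" by (simp add: funpow_swap1)
      then show ?thesis ..
    qed
  qed
  define F where "F = {(u, v). u \<in> pverts G \<and> v \<in> pverts G \<and> (f u = v \<or> f v = u)}"
  have F_sub: "F \<subseteq> parcs G" using f_arc sym by (auto simp: F_def dest: symD)
  have F_sym: "sym F" by (auto simp: F_def sym_def)
  have F_pow: "(v, (f ^^ m) v) \<in> F\<^sup>* \<and> (f ^^ m) v \<in> pverts G" if "v \<in> pverts G" for v m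
    using that f_V by (induction m) (auto simp: F_def intro: rtrancl_into_rtrancl)
  have F_root: "(v, p 0) \<in> F\<^sup>*" if v: "v \<in> pverts G" for v
  proof -
    obtain m where m: "(f ^^ m) v \<in> C" using reach[OF v] by blast
    obtain i where "p 0 = (f ^^ i) ((f ^^ m) v)" using orbitE[OF m p0] by blast
    then show ?thesis using F_pow[OF v, of m] F_pow[of "(f ^^ m) v" i] by (metis rtrancl_trans)
  qed
  have "parcs G \<subseteq> F"
  proof (rule subrelI, rule ccontr)
    fix u v assume uv: "(u, v) \<in> parcs G" "(u, v) \<notin> F"
    have V: "u \<in> pverts G" "v \<in> pverts G" using uv arc_in_verts[OF wf] by auto
    have "(p 0, v) \<in> F\<^sup>*" using F_root[OF V(2)] sym_rtrancl[OF F_sym] by (auto dest: symD)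
    then have "(u, v) \<in> F\<^sup>*" using F_root[OF V(1)] by (rule rtrancl_trans[rotated])
    then obtain n q where q: "q 0 = u" "q n = v" "\<And>i. i < n \<Longrightarrow> (q i, q (Suc i)) \<in> F"
      and inj_q: "inj_on q {..n}" by (rule shortest_path) blast
    have "n \<noteq> 0" using q(1,2) pair_graph_loopfree[OF G uv(1)] by (cases n) auto
    moreover have "n \<noteq> 1" using q uv(2) by auto
    ultimately have n: "3 \<le> Suc n" by simp
    have step: "(q i, q (Suc i mod Suc n)) \<in> parcs G" if "i < Suc n" for i
      using that q F_sub uv(1) sym by (cases "i = n") (auto dest: symD)
    let ?C = "edge_graph (q ` {..<Suc n}) {(q i, q (Suc i mod Suc n)) |i. i < Suc n}"
    have "is_cycle_of ?C G"
      unfolding is_cycle_of_iff[OF G]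
    proof (intro exI conjI)
      show "inj_on q {..<Suc n}" using inj_q by (simp add: lessThan_Suc_atMost)
      show "q ` {..<Suc n} \<subseteq> pverts G" using step arc_in_verts[OF wf] by blast
    qed (use n step in auto)
    then have "?C = C0" by (rule unique)
    moreover have "(v, u) \<in> parcs ?C"
      using q by (auto simp: edge_graph_def intro!: exI[of _ n])
    ultimately have "(v, u) \<in> parcs C0" by simp
    \<comment> \<open>The new cycle contains the arc \<open>(v, u)\<close>, which \<open>C0\<close>
      cannot contain, since all arcs of \<open>C0\<close> belong to \<open>F\<close>.\<close>
    moreover have "parcs C0 \<subseteq> F"
      using f_p sub(1) k by (auto simp: C0_eq edge_graph_def F_def)
    ultimately show False using uv(2) F_sym by (auto dest: symD)
  qed
  with F_sub have "parcs G = F" by blast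
  then have "\<And>u v. (u, v) \<in> parcs G \<longleftrightarrow> u \<in> pverts G \<and> v \<in> pverts G \<and> (f u = v \<or> f v = u)"
    by (simp add: F_def)
  moreover have "admissible (pverts G)"
    unfolding admissible_def using pair_graph_finite[OF G] sub(1) f_V reach by (auto simp: C_def)
  ultimately show thesis using that cyclic_map_axioms by blast
qed

section \<open>Isolation numbers of the extremal graphs\<close>

lemma closed_nbhd_memI:
  "v \<in> pverts G \<Longrightarrow> v \<in> D \<or> (\<exists>u\<in>D. (u, v) \<in> parcs G) \<Longrightarrow> v \<in> closed_nbhd G D"
  by (auto simp: closed_nbhd_def)

lemma path_graph_3: "pverts (path_graph 3) = {0, 1, 2}"
    "parcs (path_graph 3) = {(0, 1), (1, 2), (1, 0), (2, 1)}"
  by (auto simp: path_graph_def edge_graph_def)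

lemma cycle_graph_3: "pverts (cycle_graph 3) = {0, 1, 2}"
    "parcs (cycle_graph 3) = {(0, 1), (1, 2), (2, 0), (1, 0), (2, 1), (0, 2)}"
proof -
  have "{(i, Suc i mod 3) |i. i < 3} = (\<lambda>i. (i, Suc i mod 3)) ` {..<3}" by blast
  also have "{..<3::nat} = {0, 1, 2}" by auto
  also have "(\<lambda>i. (i, Suc i mod 3)) ` {0, 1, 2::nat} = {(0, 1), (1, 2), (2, 0)}"
    by (simp add: numeral_2_eq_2)
  finally have "{(i, Suc i mod 3) |i. i < 3} = {(0, 1), (1, 2), (2, 0)}" .
  then show "parcs (cycle_graph 3) = {(0, 1), (1, 2), (2, 0), (1, 0), (2, 1), (0, 2)}"
    by (auto simp: cycle_graph_def edge_graph_def)
qed (auto simp: cycle_graph_def edge_graph_def)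

lemma cycle_graph_arc:
  "i < k \<Longrightarrow> (i, Suc i mod k) \<in> parcs (cycle_graph k) \<and> (Suc i mod k, i) \<in> parcs (cycle_graph k)"
  by (auto simp: cycle_graph_def edge_graph_def)

lemma pverts_cycle_graph [simp]: "pverts (cycle_graph k) = {..<k}"
  by (simp add: cycle_graph_def edge_graph_def)

lemma H6_graph: "pverts (H6 S) = {0, 1, 2, 3, 4, 5}"
    "parcs (H6 S) = {(1, 2), (2, 3), (3, 4), (4, 5), (5, 1), (2, 1), (3, 2), (4, 3), (5, 4), (1, 5)}
      \<union> {0} \<times> S \<union> S \<times> {0}"
  by (auto simp: H6_def edge_graph_def)

lemma attachable_cases:
  assumes "B \<in> attachable"
  obtains "B = path_graph 3" | "B = cycle_graph 3" | S where "B = H6 S" "1 \<in> S" "S \<subseteq> {1, 2, 3}"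
  using assms unfolding attachable_def by auto

lemma attachable_wf:
  assumes "B \<in> attachable"
  shows "pair_wf_digraph B" "finite (pverts B)" "0 \<in> pverts B"
  using assms by (cases rule: attachable_cases;
    force simp: pair_wf_digraph_def path_graph_3 cycle_graph_3 H6_graph)+

text \<open>\<open>{0, 3}\<close> meets P_3 and C_3 in the circled vertex only, so one formula
  serves all six graphs. In \<open>H6 S\<close> the vertex 3 dominates 2, 3 and 4, and 0 dominates
  1, which leaves at most the vertex 5.\<close>

lemma attachable_upper:
  assumes "B \<in> attachable"
  shows "card (pverts B) = 3 * card ({0, 3} \<inter> pverts B)"
    and "(i, j) \<in> parcs B \<Longrightarrow> i \<in> closed_nbhd B ({0, 3} \<inter> pverts B) \<or> j \<in> closed_nbhd B ({0, 3} \<inter> pverts B)"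
  using assms
  by (cases rule: attachable_cases;
    auto simp: path_graph_3 cycle_graph_3 H6_graph closed_nbhd_def)+

text \<open>A vertex of the pentagon dominates just three consecutive vertices of it and misses the
  edge between the other two; the circled vertex dominates at most 1, 2 and 3 there and misses the
  edge between 4 and 5.\<close>

lemma H6_no_single:
  assumes "S \<subseteq> {1, 2, 3}" "b \<in> pverts (H6 S)"
  shows "\<exists>i j. (i, j) \<in> parcs (H6 S) \<and> i \<noteq> 0 \<and> j \<noteq> 0 \<and>
    i \<notin> closed_nbhd (H6 S) {b} \<and> j \<notin> closed_nbhd (H6 S) {b}"
proof -
  consider "b \<in> {0, 2}" | "b = 1" | "b = 3" | "b = 4" | "b = 5"
    using assms(2) by (auto simp: H6_graph)
  then show ?thesis
  proof cases
    case 1 then show ?thesis using assms(1)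
      by (intro exI[of _ 4] exI[of _ 5]) (auto simp: H6_graph closed_nbhd_def)
  next
    case 2 then show ?thesis using assms(1)
      by (intro exI[of _ 3] exI[of _ 4]) (auto simp: H6_graph closed_nbhd_def)
  next
    case 3 then show ?thesis using assms(1)
      by (intro exI[of _ 5] exI[of _ 1]) (auto simp: H6_graph closed_nbhd_def)
  next
    case 4 then show ?thesis using assms(1)
      by (intro exI[of _ 1] exI[of _ 2]) (auto simp: H6_graph closed_nbhd_def)
  next
    case 5 then show ?thesis using assms(1)
      by (intro exI[of _ 2] exI[of _ 3]) (auto simp: H6_graph closed_nbhd_def)
  qed
qed

text \<open>
  Only edges avoiding the circled vertex are considered, since these cannot be dominated from
  outside the attached copy.
\<close>

lemma attachable_lower:
  assumes "B \<in> attachable" "X \<subseteq> pverts B"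
    and X: "\<And>i j. (i, j) \<in> parcs B \<Longrightarrow> i \<noteq> 0 \<Longrightarrow> j \<noteq> 0 \<Longrightarrow> i \<in> closed_nbhd B X \<or> j \<in> closed_nbhd B X"
  shows "card (pverts B) \<le> 3 * card X"
proof -
  have fin: "finite X" using assms attachable_wf finite_subset by blast
  have "(1, 2) \<in> parcs B" using assms(1)
    by (cases rule: attachable_cases) (auto simp: path_graph_3 cycle_graph_3 H6_graph)
  then have "X \<noteq> {}" using X[of 1 2] by (auto simp: closed_nbhd_def)
  then have pos: "1 \<le> card X" using fin by (simp add: Suc_le_eq card_gt_0_iff)
  from assms(1) show ?thesis
  proof (cases rule: attachable_cases)
    case (3 S)
    have "card X \<noteq> 1"
    proof
      assume "card X = 1"
      then obtain b where "X = {b}" by (auto simp: card_1_singleton_iff)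
      then show False using H6_no_single[of S b] X assms(2) 3 by blast
    qed
    then show ?thesis using pos 3 by (simp add: H6_graph)
  qed (use pos in \<open>simp_all add: path_graph_3 cycle_graph_3\<close>)
qed

lemma attach_wf:
  assumes "pair_wf_digraph G0" "\<And>v. v \<in> pverts G0 \<Longrightarrow> A v \<in> attachable"
  shows "pair_wf_digraph (attach G0 A)"
proof -
  have "\<And>v i j. v \<in> pverts G0 \<Longrightarrow> (i, j) \<in> parcs (A v) \<Longrightarrow> i \<in> pverts (A v) \<and> j \<in> pverts (A v)"
    using arc_in_verts[OF attachable_wf(1)[OF assms(2)]] .
  then show ?thesis
    using arc_in_verts[OF assms(1)] attachable_wf(3) assms(2)
    by unfold_locales (fastforce simp: attach_def)+
qed

text \<open>Both bounds are obtained copy by copy. The set for the upper bound contains all circled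
  vertices and so covers the edges of \<open>G0\<close> as well; for the lower bound, the part of an
  isolating set in one copy must settle the edges avoiding its circled vertex.\<close>

lemma isolation_number_attach:
  assumes G0: "pair_graph G0" and A: "\<And>v. v \<in> pverts G0 \<Longrightarrow> A v \<in> attachable"
  shows "3 * isolation_number (attach G0 A) = card (pverts (attach G0 A))"
proof (rule antisym)
  let ?G = "attach G0 A"
  have fin0: "finite (pverts G0)" using pair_graph_finite[OF G0] .
  have wf: "pair_wf_digraph ?G" using attach_wf[OF pair_graph_wf[OF G0]] A by blast
  have verts: "pverts ?G = (SIGMA v:pverts G0. pverts (A v))" by (simp add: attach_def)
  have fin: "finite (pverts ?G)" unfolding verts using fin0 A attachable_wf(2) by blast
  have card: "card (pverts ?G) = (\<Sum>v\<in>pverts G0. card (pverts (A v)))"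
    unfolding verts using fin0 A attachable_wf(2) by simp

  let ?D = "SIGMA v:pverts G0. {0, 3} \<inter> pverts (A v)"
  have D: "?D \<subseteq> pverts ?G" by (auto simp: verts)
  have nbhd: "(v, i) \<in> closed_nbhd ?G ?D"
    if "v \<in> pverts G0" "i \<in> closed_nbhd (A v) ({0, 3} \<inter> pverts (A v))" for v i
    using that unfolding closed_nbhd_def attach_def by auto
  have "isolating ?G ?D"
    unfolding isolating_iff[OF wf]
  proof (intro conjI D ballI, clarify)
    fix v i w j
    assume arc: "((v, i), (w, j)) \<in> parcs ?G" and no: "(w, j) \<notin> closed_nbhd ?G ?D"
    from arc consider "i = 0" "v \<in> pverts G0" | "v = w" "v \<in> pverts G0" "(i, j) \<in> parcs (A v)"
      using arc_in_verts[OF pair_graph_wf[OF G0]] by (auto simp: attach_def)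
    then show "(v, i) \<in> closed_nbhd ?G ?D"
    proof cases
      case 1
      then have "0 \<in> closed_nbhd (A v) ({0, 3} \<inter> pverts (A v))"
        using attachable_wf(3)[OF A[OF 1(2)]] by (auto simp: closed_nbhd_def)
      then show ?thesis using nbhd 1 by blast
    next
      case 2
      then show ?thesis using attachable_upper(2)[OF A] nbhd no by blast
    qed
  qed
  then have "isolation_number ?G \<le> card ?D" by (rule isolation_number_le[OF fin])
  also have "card ?D = (\<Sum>v\<in>pverts G0. card ({0, 3} \<inter> pverts (A v)))" using fin0 by simp
  also have "3 * \<dots> = card (pverts ?G)"
    unfolding card sum_distrib_left using attachable_upper(1) A by (intro sum.cong) auto
  finally show "3 * isolation_number ?G \<le> card (pverts ?G)" by simp

  obtain X where X: "isolating ?G X" "card X = isolation_number ?G"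
    using isolation_number_attained[OF fin] .
  define Y where "Y v = {i. (v, i) \<in> X}" for v
  have sub: "X \<subseteq> pverts ?G" using X(1) by (simp add: isolating_def)
  have X_eq: "X = (SIGMA v:pverts G0. Y v)" using sub by (auto simp: Y_def verts)
  have Y_sub: "Y v \<subseteq> pverts (A v)" for v using sub by (auto simp: Y_def verts)
  have Y_fin: "finite (Y v)" if "v \<in> pverts G0" for v
    using Y_sub attachable_wf(2)[OF A[OF that]] by (rule finite_subset)
  have "card (pverts (A v)) \<le> 3 * card (Y v)" if v: "v \<in> pverts G0" for v
  proof (rule attachable_lower[OF A[OF v] Y_sub])
    fix i j assume ij: "(i, j) \<in> parcs (A v)" "i \<noteq> 0" "j \<noteq> 0"
    \<comment> \<open>A vertex other than the circled one has all its neighbours in its own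
      copy.\<close>
    have local: "l \<in> closed_nbhd (A v) (Y v)" if "(v, l) \<in> closed_nbhd ?G X" "l \<noteq> 0" for l
      using that by (auto simp: closed_nbhd_def attach_def Y_def)
    have "((v, i), (v, j)) \<in> parcs ?G" using v ij by (auto simp: attach_def)
    then have "(v, i) \<in> closed_nbhd ?G X \<or> (v, j) \<in> closed_nbhd ?G X"
      using X(1) unfolding isolating_iff[OF wf] by blast
    then show "i \<in> closed_nbhd (A v) (Y v) \<or> j \<in> closed_nbhd (A v) (Y v)" using local ij by blast
  qed
  then have "card (pverts ?G) \<le> (\<Sum>v\<in>pverts G0. 3 * card (Y v))"
    unfolding card by (rule sum_mono)
  also have "\<dots> = 3 * (\<Sum>v\<in>pverts G0. card (Y v))" by (simp only: sum_distrib_left)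
  also have "(\<Sum>v\<in>pverts G0. card (Y v)) = card X"
    unfolding X_eq using fin0 Y_fin by (subst card_SigmaI) auto
  finally show "card (pverts ?G) \<le> 3 * isolation_number ?G" using X(2) by simp
qed

lemma isolation_number_family_G:
  assumes "G \<in> family_G"
  shows "3 * isolation_number G = card (pverts G)"
proof -
  obtain G0 :: "'a pair_pre_digraph" and A h where G0: "pair_graph G0" "\<forall>v\<in>pverts G0. A v \<in> attachable"
    and h: "iso_by h G (attach G0 A)"
    using assms by (auto simp: family_G_def digraph_iso_iff)
  have "card (pverts (attach G0 A)) = card (pverts G)" using h by (simp add: iso_by_def card_image)
  then show ?thesis
    using isolation_number_attach[of G0 A] G0 isolation_number_iso[OF h] by simp
qed

section \<open>Isolation numbers of short cycles\<close>

lemma card_four: "card {a, b, c, d} \<le> 4"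
  by (simp add: card_insert_if)

text \<open>The edge from \<open>i\<close> to its successor is charged to a chosen vertex
  \<open>d\<close> that dominates one of its ends; then \<open>i\<close> is one of the four
  positions from \<open>d - 2\<close> to \<open>d + 1\<close>, taken cyclically.\<close>

lemma cycle_isolating_card:
  assumes k: "0 < k" and D: "isolating (cycle_graph k) D"
  shows "k \<le> 4 * card D"
proof -
  define pred where "pred i = (i + k - 1) mod k" for i
  have pred: "pred (Suc i mod k) = i" if "i < k" for i
    using that by (cases "Suc i = k") (auto simp: pred_def)
  have D_sub: "D \<subseteq> {..<k}" using D by (simp add: isolating_def cycle_graph_def edge_graph_def)
  then have fin: "finite D" by (rule finite_subset) simp
  let ?F = "\<lambda>d. {d, Suc d mod k, pred d, pred (pred d)}"
  have "{..<k} \<subseteq> (\<Union>d\<in>D. ?F d)"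
  proof
    fix i assume "i \<in> {..<k}"
    then have i: "i < k" by simp
    have nbhd: "\<exists>d\<in>D. v = d \<or> v = Suc d mod k \<or> d = Suc v mod k" if "v \<in> closed_nbhd (cycle_graph k) D" for v
      using that by (auto simp: closed_nbhd_def cycle_graph_def edge_graph_def)
    have "(i, Suc i mod k) \<in> parcs (cycle_graph k)" using i by (auto simp: cycle_graph_def edge_graph_def)
    then have "i \<in> closed_nbhd (cycle_graph k) D \<or> Suc i mod k \<in> closed_nbhd (cycle_graph k) D"
      using D unfolding isolating_iff[OF wf_cycle_graph[OF k]] by blast
    then obtain d where d: "d \<in> D" "i = d \<or> i = Suc d mod k \<or> d = Suc i mod k \<or>
        Suc i mod k = Suc d mod k \<or> d = Suc (Suc i mod k) mod k"
      using nbhd by blast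
    moreover have "d < k" using d D_sub by auto
    ultimately have "i = d \<or> i = Suc d mod k \<or> i = pred d \<or> i = pred (pred d)"
      using pred[OF i] pred[of d] pred[of "Suc i mod k"] k by (metis mod_less_divisor)
    then show "i \<in> (\<Union>d\<in>D. ?F d)" using d by blast
  qed
  then have "card {..<k} \<le> card (\<Union>d\<in>D. ?F d)"
    by (rule card_mono[rotated]) (use fin in simp)
  also have "\<dots> \<le> (\<Sum>d\<in>D. card (?F d))" using fin by (rule card_UN_le)
  also have "\<dots> \<le> (\<Sum>d\<in>D. 4)" by (intro sum_mono card_four)
  finally show ?thesis by simp
qed

text \<open>For positive \<open>m\<close>, a quarter of \<open>3 * m\<close>, rounded up, equals
  \<open>m\<close> only as long as \<open>m\<close> is at most 3; there the lower bound meets the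
  choice of every third vertex.\<close>

lemma isolation_number_cycle_multiple_of_3:
  assumes "0 < m" "m \<le> 3"
  shows "isolation_number (cycle_graph (3 * m)) = m"
proof (rule antisym)
  let ?G = "cycle_graph (3 * m)" and ?D = "(\<lambda>j. 3 * j) ` {..<m}"
  have fin: "finite (pverts ?G)" by (simp add: cycle_graph_def edge_graph_def)
  have wf: "pair_wf_digraph ?G" using assms by (intro wf_cycle_graph) simp
  have D: "3 * j \<in> ?D" if "j < m" for j using that by simp
  have nbhd: "v \<in> closed_nbhd ?G ?D" if v: "v < 3 * m" for v
  proof -
    have in_V: "v \<in> pverts ?G" using v by simp
    obtain q where "v = 3 * q \<or> v = 3 * q + 1 \<or> v = 3 * q + 2" using third_cases by blast
    then consider "v = 3 * q" "q < m" | "v = Suc (3 * q)" "q < m"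
      | "Suc v = 3 * Suc q" "Suc q < m" | "Suc v = 3 * m" using v by (elim disjE) force+
    then show ?thesis
    proof cases
      case 1
      then show ?thesis using D[of q] in_V by (intro closed_nbhd_memI) blast+
    next
      case 2
      then have "(3 * q, v) \<in> parcs ?G"
        using cycle_graph_arc[of "3 * q" "3 * m"] v by (metis Suc_lessD mod_less)
      then show ?thesis using D[of q] 2 in_V by (intro closed_nbhd_memI) blast+
    next
      case 3
      then have "3 * Suc q < 3 * m" by simp
      then have "Suc v mod (3 * m) = 3 * Suc q" unfolding 3(1) by (rule mod_less)
      then have "(3 * Suc q, v) \<in> parcs ?G" using cycle_graph_arc[OF v] by metis
      then show ?thesis using D[of "Suc q"] 3 in_V by (intro closed_nbhd_memI) blast+
    next
      case 4
      then have "(0, v) \<in> parcs ?G" using cycle_graph_arc[OF v] by simp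
      moreover have "0 \<in> ?D" using D[of 0] assms by simp
      ultimately show ?thesis using in_V by (intro closed_nbhd_memI) blast+
    qed
  qed
  have "isolating ?G ?D"
    unfolding isolating_iff[OF wf] using arc_in_verts[OF wf] nbhd by auto
  then have "isolation_number ?G \<le> card ?D" by (rule isolation_number_le[OF fin])
  also have "card ?D \<le> m" using card_image_le[of "{..<m}" "\<lambda>j. 3 * j"] by simp
  finally show "isolation_number ?G \<le> m" .
  obtain X where "isolating ?G X" "card X = isolation_number ?G"
    using isolation_number_attained[OF fin] .
  then have "3 * m \<le> 4 * isolation_number ?G"
    using cycle_isolating_card[of "3 * m" X] assms by simp
  then show "m \<le> isolation_number ?G" using assms by linarith
qed

section \<open>Extremal maps give members of the family\<close>

definition adjacent :: "('a \<Rightarrow> 'a) \<Rightarrow> 'a \<Rightarrow> 'a \<Rightarrow> bool" where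
  "adjacent f u v \<longleftrightarrow> f u = v \<or> f v = u"

text \<open>For a set \<open>R\<close> of roots these will be the arcs of \<open>G0\<close>.\<close>

definition joined :: "('a \<Rightarrow> 'a) \<Rightarrow> 'a set \<Rightarrow> ('a \<times> 'a) set" where
  "joined f R = {(u, v). u \<in> R \<and> v \<in> R \<and> adjacent f u v}"

lemma sym_joined: "sym (joined f R)"
  by (auto simp: joined_def adjacent_def sym_def)

text \<open>
  The map \<open>\<phi>\<close> sends a vertex to its root in \<open>R\<close> and its name in the copy attached there.
\<close>

definition attached ::
  "('a \<Rightarrow> 'a) \<Rightarrow> 'a set \<Rightarrow> 'a set \<Rightarrow> ('a \<Rightarrow> nat pair_pre_digraph) \<Rightarrow> ('a \<Rightarrow> 'a \<times> nat) \<Rightarrow> bool" where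
  "attached f V R A \<phi> \<longleftrightarrow> (\<forall>r\<in>R. A r \<in> attachable \<and> \<phi> r = (r, 0)) \<and> R \<subseteq> V \<and>
     bij_betw \<phi> V (SIGMA r:R. pverts (A r)) \<and>
     (\<forall>u\<in>V. \<forall>v\<in>V. adjacent f u v \<longleftrightarrow>
        fst (\<phi> u) = fst (\<phi> v) \<and> (snd (\<phi> u), snd (\<phi> v)) \<in> parcs (A (fst (\<phi> u))) \<or>
        snd (\<phi> u) = 0 \<and> snd (\<phi> v) = 0 \<and> adjacent f (fst (\<phi> u)) (fst (\<phi> v))) \<and>
     (\<forall>u\<in>R. \<forall>v\<in>R. (u, v) \<in> (joined f R)\<^sup>*)"

lemma attachedI:
  assumes "\<And>r. r \<in> R \<Longrightarrow> A r \<in> attachable" "\<And>r. r \<in> R \<Longrightarrow> \<phi> r = (r, 0)" "R \<subseteq> V"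
    and "bij_betw \<phi> V (SIGMA r:R. pverts (A r))"
    and "\<And>u v. u \<in> V \<Longrightarrow> v \<in> V \<Longrightarrow> adjacent f u v \<longleftrightarrow>
        fst (\<phi> u) = fst (\<phi> v) \<and> (snd (\<phi> u), snd (\<phi> v)) \<in> parcs (A (fst (\<phi> u))) \<or>
        snd (\<phi> u) = 0 \<and> snd (\<phi> v) = 0 \<and> adjacent f (fst (\<phi> u)) (fst (\<phi> v))"
    and "\<And>u v. u \<in> R \<Longrightarrow> v \<in> R \<Longrightarrow> (u, v) \<in> (joined f R)\<^sup>*"
  shows "attached f V R A \<phi>"
  unfolding attached_def by (intro conjI ballI; rule assms; assumption)

lemma bij_betw_Sigma_fst:
  assumes "bij_betw \<phi> V (SIGMA r:R. B r)" "v \<in> V"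
  shows "fst (\<phi> v) \<in> R"
proof -
  have "\<phi> v \<in> (SIGMA r:R. B r)" using bij_betwE[OF assms(1)] assms(2) by blast
  then show ?thesis by auto
qed

lemma attached_family_G:
  fixes G :: "'a pair_pre_digraph"
  assumes G: "pair_graph G" and arcs: "\<And>u v. (u, v) \<in> parcs G \<longleftrightarrow>
      u \<in> pverts G \<and> v \<in> pverts G \<and> adjacent f u v"
    and att: "attached f (pverts G) R A \<phi>" and "R \<noteq> {}"
  shows "G \<in> family_G"
proof -
  let ?G0 = "\<lparr>pverts = R, parcs = joined f R\<rparr>"
  have R: "R \<subseteq> pverts G" "\<And>r. r \<in> R \<Longrightarrow> A r \<in> attachable" "\<And>r. r \<in> R \<Longrightarrow> \<phi> r = (r, 0)"
    and bij: "bij_betw \<phi> (pverts G) (SIGMA r:R. pverts (A r))"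
    and adj: "\<And>u v. u \<in> pverts G \<Longrightarrow> v \<in> pverts G \<Longrightarrow> adjacent f u v \<longleftrightarrow>
        fst (\<phi> u) = fst (\<phi> v) \<and> (snd (\<phi> u), snd (\<phi> v)) \<in> parcs (A (fst (\<phi> u))) \<or>
        snd (\<phi> u) = 0 \<and> snd (\<phi> v) = 0 \<and> adjacent f (fst (\<phi> u)) (fst (\<phi> v))"
    and conn: "\<And>u v. u \<in> R \<Longrightarrow> v \<in> R \<Longrightarrow> (u, v) \<in> (joined f R)\<^sup>*"
    using att unfolding attached_def by blast+
  have sub: "joined f R \<subseteq> parcs G" using R(1) arcs by (auto simp: joined_def)
  have finR: "finite R" using R(1) pair_graph_finite[OF G] by (rule finite_subset)
  have "joined f R \<subseteq> R \<times> R" by (auto simp: joined_def)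
  then have "finite (joined f R)" using finR by (meson finite_SigmaI finite_subset)
  moreover have "u \<noteq> v" if "(u, v) \<in> joined f R" for u v
    using that sub pair_graph_loopfree[OF G] by blast
  ultimately have G0: "pair_graph ?G0"
    using finR sym_joined[of f R] by unfold_locales (auto simp: joined_def symmetric_def)
  have conn0: "connected (with_proj ?G0)"
    using connected_iff[OF pair_graph_wf[OF G0] pair_graph_sym[OF G0]] conn assms(4) by simp
  have verts: "\<phi> ` pverts G = pverts (attach ?G0 A)"
    using bij by (simp add: bij_betw_def attach_def)
  have "parcs (attach ?G0 A) = map_prod \<phi> \<phi> ` parcs G"
  proof (intro equalityI[rotated] subsetI)
    fix e assume "e \<in> map_prod \<phi> \<phi> ` parcs G"
    then obtain u v where uv: "e = (\<phi> u, \<phi> v)" "(u, v) \<in> parcs G" by auto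
    then have V: "u \<in> pverts G" "v \<in> pverts G" "adjacent f u v" using arcs by auto
    have "fst (\<phi> u) \<in> R" "fst (\<phi> v) \<in> R" using bij_betw_Sigma_fst[OF bij] V by auto
    then show "e \<in> parcs (attach ?G0 A)"
      using adj[OF V(1,2)] V(3) uv(1)
      by (cases "\<phi> u"; cases "\<phi> v") (auto simp: attach_def joined_def)
  next
    fix e assume "e \<in> parcs (attach ?G0 A)"
    then consider u v where "e = ((u, 0), (v, 0))" "(u, v) \<in> joined f R"
      | v i j where "e = ((v, i), (v, j))" "v \<in> R" "(i, j) \<in> parcs (A v)"
      by (auto simp: attach_def)
    then show "e \<in> map_prod \<phi> \<phi> ` parcs G"
    proof cases
      case 1
      then have "u \<in> R" "v \<in> R" by (simp_all add: joined_def)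
      then have "e = map_prod \<phi> \<phi> (u, v)" using R(3)[of u] R(3)[of v] 1(1) by simp
      then show ?thesis using 1(2) sub by blast
    next
      case 2
      then have "(v, i) \<in> \<phi> ` pverts G" "(v, j) \<in> \<phi> ` pverts G"
        using arc_in_verts[OF attachable_wf(1)[OF R(2)]] bij by (auto simp: bij_betw_def)
      then obtain a b where ab: "a \<in> pverts G" "b \<in> pverts G" "\<phi> a = (v, i)" "\<phi> b = (v, j)"
        by (metis imageE)
      then have "(a, b) \<in> parcs G" using adj[of a b] 2(3) arcs by simp
      then show ?thesis using ab 2(1) by (intro image_eqI[of _ _ "(a, b)"]) simp_all
    qed
  qed
  then have "iso_by \<phi> G (attach ?G0 A)"
    unfolding iso_by_def
    using pair_graph_wf[OF G] bij_betw_imp_inj_on[OF bij] verts[symmetric] by blast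
  then show ?thesis
    unfolding family_G_def digraph_iso_iff using G0 conn0 R(2)
    by (auto intro!: exI[of _ ?G0] exI[of _ A])
qed

lemma iso_by_card: "iso_by h G H \<Longrightarrow> card (pverts G) = card (pverts H)"
  by (simp add: iso_by_def card_image)

section \<open>Copies and vertex names for the extremal maps\<close>

context cyclic_map
begin

lemma joined_C: "u \<in> C \<Longrightarrow> v \<in> C \<Longrightarrow> (u, v) \<in> (joined f C)\<^sup>*"
proof -
  assume u: "u \<in> C" and v: "v \<in> C"
  have "(u, (f ^^ i) u) \<in> (joined f C)\<^sup>*" for i
  proof (induction i)
    case (Suc i)
    have "((f ^^ i) u, (f ^^ Suc i) u) \<in> joined f C"
      using funpow_in_C[OF u, of i] f_in_C by (simp add: joined_def adjacent_def)
    with Suc show ?case by (rule rtrancl_into_rtrancl)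
  qed simp
  then show "(u, v) \<in> (joined f C)\<^sup>*" using orbitE[OF u v] by metis
qed

lemma attached_triangle:
  assumes "k = 3" "c \<in> C"
  shows "attached f C {c} (\<lambda>_. cycle_graph 3)
    (\<lambda>v. (c, if v = c then 0 else if v = f c then 1 else 2))"
proof -
  define d e where "d = f c" and "e = f d"
  have "{..<3::nat} = {0, 1, 2}" by auto
  then have C: "C = {c, d, e}" and fe: "f e = c"
    using orbit[OF assms(2)] period[OF assms(2)] assms(1)
    by (simp_all add: eval_nat_numeral d_def e_def)
  have distinct: "c \<noteq> d" "c \<noteq> e" "d \<noteq> e"
    using card_C assms(1) unfolding C by (auto simp: card_insert_if split: if_splits)
  have "bij_betw (\<lambda>v. (c, if v = c then 0 else if v = f c then 1 else 2)) C
      (SIGMA r:{c}. pverts (cycle_graph 3))"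
    using distinct unfolding C d_def[symmetric]
    by (auto simp: bij_betw_def inj_on_def cycle_graph_3 simp del: pverts_cycle_graph)
  then show ?thesis
    using distinct fe unfolding attached_def C adjacent_def
    by (auto simp: attachable_def cycle_graph_3 d_def[symmetric] e_def[symmetric])
qed

lemma attached_lollipop:
  assumes "k = 5" "x \<notin> C" "f x \<in> C"
  shows "\<exists>A \<phi>. attached f (insert x C) {x} A \<phi>"
proof -
  define c1 where "c1 = f x"
  define c2 where "c2 = f c1"
  define c3 where "c3 = f c2"
  define c4 where "c4 = f c3"
  define c5 where "c5 = f c4"
  have C: "C = {c1, c2, c3, c4, c5}" and f5: "f c5 = c1"
    using five_cycle[OF assms(1,3)] by (simp_all add: c1_def c2_def c3_def c4_def c5_def)
  have f: "f x = c1" "f c1 = c2" "f c2 = c3" "f c3 = c4" "f c4 = c5" "f c5 = c1"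
    using f5 by (simp_all add: c1_def c2_def c3_def c4_def c5_def)
  have distinct: "distinct [x, c1, c2, c3, c4, c5]"
  proof -
    have "card (set [c1, c2, c3, c4, c5]) = length [c1, c2, c3, c4, c5]"
      using card_C assms(1) unfolding C by simp
    then have "distinct [c1, c2, c3, c4, c5]" by (rule card_distinct)
    then show ?thesis using assms(2) unfolding C by simp
  qed
  define n :: "'a \<Rightarrow> nat" where "n = (\<lambda>_. 0)(c1 := 1, c2 := 2, c3 := 3, c4 := 4, c5 := 5)"
  have n: "n x = 0" "n c1 = 1" "n c2 = 2" "n c3 = 3" "n c4 = 4" "n c5 = 5"
    using distinct by (auto simp: n_def)
  have neq: "x \<noteq> c1" "x \<noteq> c2" "x \<noteq> c3" "x \<noteq> c4" "x \<noteq> c5" "c1 \<noteq> c2" "c1 \<noteq> c3" "c1 \<noteq> c4" "c1 \<noteq> c5"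
    "c2 \<noteq> c3" "c2 \<noteq> c4" "c2 \<noteq> c5" "c3 \<noteq> c4" "c3 \<noteq> c5" "c4 \<noteq> c5"
    using distinct by auto
  have V: "insert x C = {x, c1, c2, c3, c4, c5}" by (simp add: C)
  have "bij_betw (\<lambda>v. (x, n v)) (insert x C) (SIGMA r:{x}. pverts (H6 {1}))"
    unfolding V by (auto simp: bij_betw_def inj_on_def H6_graph n)
  moreover have "\<forall>u\<in>insert x C. \<forall>v\<in>insert x C. adjacent f u v \<longleftrightarrow>
      (n u, n v) \<in> parcs (H6 {1}) \<or> n u = 0 \<and> n v = 0 \<and> adjacent f x x"
    unfolding V adjacent_def
    by (intro ballI; elim insertE emptyE; hypsubst) (simp_all add: f n neq neq[symmetric] H6_graph)
  ultimately have "attached f (insert x C) {x} (\<lambda>_. H6 {1}) (\<lambda>v. (x, n v))"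
    unfolding attached_def by (intro conjI) (simp_all add: attachable_def n)
  then show ?thesis by blast
qed

lemma attached_crown:
  assumes gh: "\<And>c. c \<in> C \<Longrightarrow> f (g c) = c \<and> g c \<notin> C \<and> f (h c) = g c"
  shows "\<exists>A \<phi>. attached f (C \<union> g ` C \<union> h ` C) C A \<phi>"
proof -
  \<comment> \<open>A vertex is named by the first cycle vertex it reaches and the number of steps
    it takes, which matches the vertices 0, 1, 2 of \<open>path_graph 3\<close>.\<close>
  define \<phi> where "\<phi> v = (if v \<in> C then (v, 0::nat) else if f v \<in> C then (f v, 1) else (f (f v), 2))" for v
  let ?V = "C \<union> g ` C \<union> h ` C"
  have hC: "h c \<notin> C" if "c \<in> C" for c using gh[OF that] f_in_C by metis
  have \<phi>: "\<phi> c = (c, 0)" "\<phi> (g c) = (c, 1)" "\<phi> (h c) = (c, 2)" if "c \<in> C" for c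
    using gh[OF that] hC[OF that] that by (auto simp: \<phi>_def)
  have cases: thesis if "v \<in> ?V" "\<And>c. c \<in> C \<Longrightarrow> v = c \<Longrightarrow> thesis" "\<And>c. c \<in> C \<Longrightarrow> v = g c \<Longrightarrow> thesis"
    "\<And>c. c \<in> C \<Longrightarrow> v = h c \<Longrightarrow> thesis" for v thesis using that by blast
  have inj: "inj_on \<phi> ?V"
  proof (rule inj_onI)
    fix u v assume "u \<in> ?V" "v \<in> ?V" "\<phi> u = \<phi> v"
    then show "u = v" by (elim cases) (auto simp: \<phi>)
  qed
  have image: "\<phi> ` ?V = (SIGMA r:C. pverts (path_graph 3))"
    by (auto simp: path_graph_3 \<phi> image_Un image_image image_iff)
  have adj: "adjacent f u v \<longleftrightarrow>
        fst (\<phi> u) = fst (\<phi> v) \<and> (snd (\<phi> u), snd (\<phi> v)) \<in> parcs (path_graph 3) \<or>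
        snd (\<phi> u) = 0 \<and> snd (\<phi> v) = 0 \<and> adjacent f (fst (\<phi> u)) (fst (\<phi> v))"
    if uv: "u \<in> ?V" "v \<in> ?V" for u v
  proof -
    have neq: "f c \<noteq> g d" "f c \<noteq> h d" "g c \<noteq> h d" "c \<noteq> g d" "c \<noteq> h d"
      and eq: "f (g c) = c" "f (h c) = g c" "g c = g d \<longleftrightarrow> c = d" if "c \<in> C" "d \<in> C" for c d
      using gh[OF that(1)] gh[OF that(2)] f_in_C[OF that(1)] hC[OF that(2)] that by metis+
    obtain c where c: "c \<in> C" "u \<in> {c, g c, h c}" using uv(1) by blast
    obtain d where d: "d \<in> C" "v \<in> {d, g d, h d}" using uv(2) by blast
    note neqs = neq[OF c(1) d(1)] neq[OF d(1) c(1)]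
    note simps = \<phi>[OF c(1)] \<phi>[OF d(1)] eq[OF c(1) d(1)] eq[OF d(1) c(1)]
      neqs neqs[symmetric]
    from c(2) d(2) show ?thesis
      by (elim insertE emptyE) (auto simp: simps path_graph_3 adjacent_def)
  qed
  have "attached f ?V C (\<lambda>_. path_graph 3) \<phi>"
  proof (rule attachedI)
    show "path_graph 3 \<in> attachable" by (simp add: attachable_def)
    show "bij_betw \<phi> ?V (SIGMA r:C. pverts (path_graph 3))"
      unfolding bij_betw_def using inj image by blast
  qed (rule \<phi>(1) adj joined_C; assumption | blast)+
  then show ?thesis by blast
qed

text \<open>The new path becomes a copy of \<open>path_graph 3\<close> at the new root
  \<open>x\<close>. Because \<open>f x\<close> is a root, the edge between \<open>x\<close> and
  \<open>f x\<close> can become an edge of \<open>G0\<close>.\<close>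

lemma attached_hang:
  assumes att: "attached f V R A \<phi>" and V: "f ` V \<subseteq> V"
    and xyz: "f x \<in> R" "f y = x" "f z = y" "x \<notin> V" "y \<notin> V" "z \<notin> V" "x \<noteq> y" "x \<noteq> z" "y \<noteq> z"
  shows "\<exists>A \<phi>. attached f (V \<union> {x, y, z}) (insert x R) A \<phi>"
proof -
  define B where "B = A(x := path_graph 3)"
  define \<psi> where "\<psi> = \<phi>(x := (x, 0), y := (x, 1), z := (x, 2))"
  have R: "R \<subseteq> V" "\<And>r. r \<in> R \<Longrightarrow> A r \<in> attachable" "\<And>r. r \<in> R \<Longrightarrow> \<phi> r = (r, 0)"
    and bij: "bij_betw \<phi> V (SIGMA r:R. pverts (A r))"
    and adj: "\<And>u v. u \<in> V \<Longrightarrow> v \<in> V \<Longrightarrow> adjacent f u v \<longleftrightarrow>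
        fst (\<phi> u) = fst (\<phi> v) \<and> (snd (\<phi> u), snd (\<phi> v)) \<in> parcs (A (fst (\<phi> u))) \<or>
        snd (\<phi> u) = 0 \<and> snd (\<phi> v) = 0 \<and> adjacent f (fst (\<phi> u)) (fst (\<phi> v))"
    and conn: "\<And>u v. u \<in> R \<Longrightarrow> v \<in> R \<Longrightarrow> (u, v) \<in> (joined f R)\<^sup>*"
    using att unfolding attached_def by blast+
  have xR: "x \<notin> R" "y \<notin> R" "z \<notin> R" using R(1) xyz by auto
  have B: "B x = path_graph 3" "r \<noteq> x \<Longrightarrow> B r = A r" for r by (simp_all add: B_def)
  have \<psi>: "\<psi> x = (x, 0)" "\<psi> y = (x, 1)" "\<psi> z = (x, 2)" using xyz(7-9) by (auto simp: \<psi>_def)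
  have old: "\<psi> v = \<phi> v" "fst (\<phi> v) \<noteq> x" "v \<noteq> x" "v \<noteq> y" "v \<noteq> z" "f v \<noteq> x" "f v \<noteq> y" "f v \<noteq> z"
    if v: "v \<in> V" for v
  proof -
    show neq: "v \<noteq> x" "v \<noteq> y" "v \<noteq> z" using v xyz(4-6) by auto
    then show "\<psi> v = \<phi> v" by (simp add: \<psi>_def)
    show "fst (\<phi> v) \<noteq> x" using bij_betw_Sigma_fst[OF bij v] xR(1) by metis
    have "f v \<in> V" using V v by blast
    then show "f v \<noteq> x" "f v \<noteq> y" "f v \<noteq> z" using xyz(4-6) by auto
  qed
  have root_fst: "fst (\<phi> v) = v" "snd (\<phi> v) = 0" if "v \<in> R" for v
    using R(3)[OF that] by simp_all
  \<comment> \<open>Only roots carry the name 0, so an old vertex that is joined to \<open>x\<close>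
    through \<open>G0\<close> must be a root.\<close>
  have root: "v \<in> R" if v: "v \<in> V" "snd (\<phi> v) = 0" for v
  proof -
    have r: "fst (\<phi> v) \<in> R" by (rule bij_betw_Sigma_fst[OF bij v(1)])
    then have "\<phi> v = \<phi> (fst (\<phi> v))" using R(3) v(2) by (simp add: prod_eq_iff)
    then have "v = fst (\<phi> v)"
      using bij_betw_imp_inj_on[OF bij] v(1) r R(1) by (meson inj_onD subsetD)
    then show "v \<in> R" using r by simp
  qed
  have "bij_betw \<psi> V (SIGMA r:R. pverts (A r))"
    using bij old(1) by (simp cong: bij_betw_cong)
  moreover have "bij_betw \<psi> {x, y, z} ({x} \<times> {0, 1, 2})"
    using xyz(7-9) \<psi> by (auto simp: bij_betw_def)
  ultimately have "bij_betw \<psi> (V \<union> {x, y, z}) ((SIGMA r:R. pverts (A r)) \<union> {x} \<times> {0, 1, 2})"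
    using xR(1) by (intro bij_betw_combine) auto
  moreover have "(SIGMA r:insert x R. pverts (B r)) = (SIGMA r:R. pverts (A r)) \<union> {x} \<times> {0, 1, 2}"
  proof -
    have e1: "(SIGMA r:R. pverts (B r)) = (SIGMA r:R. pverts (A r))"
      using xR(1) by (intro Sigma_cong refl) (metis B(2))
    have e2: "(SIGMA r:insert x R. pverts (B r)) = (SIGMA r:R. pverts (B r)) \<union> {x} \<times> pverts (B x)"
      by blast
    show ?thesis unfolding e2 e1 B(1) path_graph_3(1) by (rule refl)
  qed
  ultimately have bij': "bij_betw \<psi> (V \<union> {x, y, z}) (SIGMA r:insert x R. pverts (B r))" by simp
  have adj': "adjacent f u v \<longleftrightarrow>
        fst (\<psi> u) = fst (\<psi> v) \<and> (snd (\<psi> u), snd (\<psi> v)) \<in> parcs (B (fst (\<psi> u))) \<or>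
        snd (\<psi> u) = 0 \<and> snd (\<psi> v) = 0 \<and> adjacent f (fst (\<psi> u)) (fst (\<psi> v))"
    if uv: "u \<in> V \<union> {x, y, z}" "v \<in> V \<union> {x, y, z}" for u v
  proof -
    have "f x \<in> V" using xyz(1) R(1) by blast
    then have fx: "f x \<noteq> x" "f x \<noteq> y" "f x \<noteq> z" using xyz(4-6) by metis+
    \<comment> \<open>The only edge between old and new vertices is the one between
      \<open>f x\<close> and \<open>x\<close>.\<close>
    have new: "adjacent f a b \<longleftrightarrow> b = x \<and> a = f x" "a = f x \<longleftrightarrow> a \<in> R \<and> adjacent f a x"
      "adjacent f b a \<longleftrightarrow> b = x \<and> a = f x" "a = f x \<longleftrightarrow> a \<in> R \<and> adjacent f x a"
      if a: "a \<in> V" and b: "b \<in> {x, y, z}" for a b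
      using b old(3-8)[OF a] xyz(1-3,7-9) by (auto simp: adjacent_def)
    have zero: "snd (\<psi> b) = 0 \<longleftrightarrow> b = x" "fst (\<psi> b) = x" if "b \<in> {x, y, z}" for b
      using that \<psi> xyz(7-9) by auto
    consider "u \<in> V" "v \<in> V" | "u \<in> V" "v \<in> {x, y, z}" | "u \<in> {x, y, z}" "v \<in> V"
      | "u \<in> {x, y, z}" "v \<in> {x, y, z}" using uv by blast
    then show ?thesis
    proof cases
      case 1
      show ?thesis
        unfolding old(1)[OF 1(1)] old(1)[OF 1(2)] B(2)[OF old(2)[OF 1(1)]] by (rule adj[OF 1])
    next
      case 2
      show ?thesis
        unfolding old(1)[OF 2(1)] zero[OF 2(2)]
        using new(1,2)[OF 2] old(2)[OF 2(1)] root[OF 2(1)] root_fst[of u] by metis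
    next
      case 3
      show ?thesis
        unfolding old(1)[OF 3(2)] zero[OF 3(1)]
        using new(3,4)[OF 3(2,1)] old(2)[OF 3(2)] root[OF 3(2)] root_fst[of v] by metis
    next
      case 4
      then show ?thesis
        by (elim insertE emptyE)
          (use fx xyz(2,3,7-9) in \<open>auto simp: \<psi> B adjacent_def path_graph_3\<close>)
    qed
  qed
  have mono: "(joined f R)\<^sup>* \<subseteq> (joined f (insert x R))\<^sup>*"
    by (rule rtrancl_mono) (auto simp: joined_def)
  have step: "(x, f x) \<in> joined f (insert x R)" using xyz(1) by (simp add: joined_def adjacent_def)
  have from_x: "(x, v) \<in> (joined f (insert x R))\<^sup>*" if "v \<in> insert x R" for v
  proof (cases "v = x")
    case False
    then have "(f x, v) \<in> (joined f (insert x R))\<^sup>*" using that conn[OF xyz(1)] mono by blast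
    with step show ?thesis by (rule converse_rtrancl_into_rtrancl)
  qed simp
  have conn': "(u, v) \<in> (joined f (insert x R))\<^sup>*" if "u \<in> insert x R" "v \<in> insert x R" for u v
    using from_x[OF that(1)] from_x[OF that(2)] sym_rtrancl[OF sym_joined]
    by (meson rtrancl_trans symD)
  have B': "B r \<in> attachable" and \<psi>': "\<psi> r = (r, 0)" if "r \<in> insert x R" for r
  proof -
    show "B r \<in> attachable"
      using that B(1) B(2)[of r] R(2)[of r] by (cases "r = x") (simp_all add: attachable_def)
    show "\<psi> r = (r, 0)"
      using that \<psi>(1) R(3)[of r] old(1)[of r] R(1) by (cases "r = x") auto
  qed
  have "attached f (V \<union> {x, y, z}) (insert x R) B \<psi>"
  proof (rule attachedI)
    show "insert x R \<subseteq> V \<union> {x, y, z}" using R(1) by blast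
  qed (rule B' \<psi>' bij' adj' conn'; assumption)+
  then show ?thesis by blast
qed

lemma blocks_attached:
  assumes "blocks V R"
  shows "R \<noteq> {} \<and> (\<exists>A \<phi>. attached f V R A \<phi>)"
  using assms
proof induction
  case (triangle c)
  then show ?case using attached_triangle by blast
next
  case (lollipop x)
  then show ?case using attached_lollipop by blast
next
  case (crown g h)
  then show ?case using attached_crown[of g h] C_nonempty by blast
next
  case (hang V R x y z)
  then obtain A \<phi> where "attached f V R A \<phi>" by blast
  then show ?case
    using attached_hang[of V R A \<phi> x y z] hang.hyps hang_card[OF hang.hyps] blocks_basic[OF hang.hyps(1)]
    by blast
qed

lemma iso_cycle_graph:
  assumes G: "pair_graph G" and V: "pverts G = C"
    and arcs: "\<And>u v. (u, v) \<in> parcs G \<longleftrightarrow> u \<in> pverts G \<and> v \<in> pverts G \<and> adjacent f u v"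
  shows "digraph_iso (with_proj G) (with_proj (cycle_graph k))"
proof -
  obtain c where c: "c \<in> C" using C_nonempty by auto
  let ?p = "\<lambda>i. (f ^^ i) c"
  have step: "?p (Suc i mod k) = f (?p i)" if "i < k" for i
    using that period[OF c] by (cases "Suc i = k") auto
  define E where "E = {(?p i, ?p (Suc i mod k)) |i. i < k}"
  have E: "(u, v) \<in> E \<longleftrightarrow> u \<in> C \<and> v = f u" for u v
  proof
    assume "u \<in> C \<and> v = f u"
    moreover from this obtain i where "i < k" "u = ?p i" using orbitE[OF c] by blast
    ultimately show "(u, v) \<in> E" using step by (auto simp: E_def)
  qed (use step funpow_in_C[OF c] in \<open>auto simp: E_def\<close>)
  have "parcs G = E \<union> E\<inverse>"
    using arcs f_in_C unfolding V adjacent_def by (auto simp: E)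
  then have "G = edge_graph (?p ` {..<k}) E"
    using V orbit[OF c] by (simp add: edge_graph_def)
  then have "iso_by ?p (cycle_graph k) G"
    using iso_by_cycle_graph[OF _ inj_orbit[OF c]] k_ge_3 by (simp add: E_def)
  then show ?thesis using iso_by_sym digraph_iso_iff by blast
qed

lemma isolates_isolating:
  assumes G: "pair_graph G" and D: "isolates f (pverts G) {} D"
    and arcs: "\<And>u v. (u, v) \<in> parcs G \<longleftrightarrow> u \<in> pverts G \<and> v \<in> pverts G \<and> adjacent f u v"
  shows "isolating G D"
proof -
  have sub: "D \<subseteq> pverts G" using D by (simp add: isolates_def)
  have "v \<in> closed_nbhd G D" if "dominates f D v" "v \<in> pverts G" for v
    using that sub by (auto simp: dominates_def closed_nbhd_def arcs adjacent_def)
  moreover have "dominates f D u \<or> dominates f D v" if "(u, v) \<in> parcs G" for u v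
    using that D by (auto simp: isolates_def arcs adjacent_def)
  ultimately show ?thesis
    unfolding isolating_iff[OF pair_graph_wf[OF G]] using sub arcs by blast
qed

end

section \<open>The unicyclic graphs with isolation number n/3\<close>

theorem theorem7:
  fixes G :: "'a pair_pre_digraph" and n :: nat
  assumes "pair_graph G" and "unicyclic G" and "card (pverts G) = n"
  shows "real (isolation_number G) = real n / 3 \<longleftrightarrow>
    G \<in> family_U \<union> {H. digraph_iso (with_proj H) (with_proj (cycle_graph 6))}
                \<union> {H. digraph_iso (with_proj H) (with_proj (cycle_graph 9))}"
proof -
  have real: "real (isolation_number G) = real n / 3 \<longleftrightarrow> 3 * isolation_number G = n"
    by linarith
  show ?thesis unfolding real
  proof
    assume eq: "3 * isolation_number G = n"
    obtain f C k where cm: "cyclic_map f C k" and adm: "cyclic_map.admissible f C (pverts G)"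
      and arcs: "\<And>u v. (u, v) \<in> parcs G \<longleftrightarrow> u \<in> pverts G \<and> v \<in> pverts G \<and> (f u = v \<or> f v = u)"
      by (rule unicyclic_cyclic_map[OF assms(1,2)]) blast
    interpret cyclic_map f C k by (rule cm)
    have arcs': "(u, v) \<in> parcs G \<longleftrightarrow> u \<in> pverts G \<and> v \<in> pverts G \<and> adjacent f u v" for u v
      using arcs by (simp add: adjacent_def)
    consider "pverts G = C" "k \<in> {5, 6, 9}"
      | D where "isolates f (pverts G) {} D" "3 * card D < card (pverts G)"
      | R where "blocks (pverts G) R"
      using isolates_or_blocks[OF adm] by blast
    then show "G \<in> family_U \<union> {H. digraph_iso (with_proj H) (with_proj (cycle_graph 6))}
        \<union> {H. digraph_iso (with_proj H) (with_proj (cycle_graph 9))}"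
    proof cases
      case 1
      have "n = k" using assms(3) 1(1) card_C by simp
      \<comment> \<open>C_5 drops out because \<open>n\<close> is a multiple of three.\<close>
      then have "k \<noteq> 5" using eq by presburger
      then show ?thesis using iso_cycle_graph[OF assms(1) 1(1) arcs'] 1(2) by auto
    next
      case 2
      have "isolation_number G \<le> card D"
        by (rule isolation_number_le[OF pair_graph_finite[OF assms(1)]
              isolates_isolating[OF assms(1) 2(1) arcs']])
      then show ?thesis using 2(2) eq assms(3) by simp
    next
      case 3
      then obtain A \<phi> where "R \<noteq> {}" "attached f (pverts G) R A \<phi>" using blocks_attached by blast
      then have "G \<in> family_G" using attached_family_G[OF assms(1) arcs'] by blast
      then show ?thesis using assms(2) by (simp add: family_U_def)
    qed
  next
    assume "G \<in> family_U \<union> {H. digraph_iso (with_proj H) (with_proj (cycle_graph 6))}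
        \<union> {H. digraph_iso (with_proj H) (with_proj (cycle_graph 9))}"
    then consider "G \<in> family_G" | h where "iso_by h G (cycle_graph 6)"
      | h where "iso_by h G (cycle_graph 9)"
      by (auto simp: family_U_def digraph_iso_iff)
    then show "3 * isolation_number G = n"
    proof cases
      case 1
      then show ?thesis using isolation_number_family_G[OF 1] assms(3) by simp
    next
      case 2
      then have "n = 6" using iso_by_card assms(3) by force
      then show ?thesis
        using isolation_number_iso[OF 2] isolation_number_cycle_multiple_of_3[of 2] by simp
    next
      case 3
      then have "n = 9" using iso_by_card assms(3) by force
      then show ?thesis
        using isolation_number_iso[OF 3] isolation_number_cycle_multiple_of_3[of 3] by simp
    qed
  qed
qed

end
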